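(* In the setting described in the context, if $\alpha>\sum_{i=1}^M p_i\alpha_i$ or, more generally, if $(k_n-\mathbb{E}(\Sigma_n))/\sqrt n\to\infty$, then the conditional laws $\mathcal{L}(\mathcal{X}_n\mid\Sigma_n\ge k_n)$ converge weakly, as $n\to\infty$, to the probability measure on $\mathbb{R}^M$ which has density $f/\int f\,d\nu_0$ with respect to $\nu_0$.
   Context: Setting. Fix an integer $M\ge1$, numbers $\alpha_1,\dots,\alpha_M\in(0,1)$ with $\sum_{i=1}^M\alpha_i=1$, a number $\alpha\in(0,1)$, and probabilities $p_1,\dots,p_M\in(0,1)$. For every $n\ge1$, nonnegative integers $m_{1n},\dots,m_{Mn}$ (block sizes) with $\sum_i m_{in}=n$ are given, with $m_{in}/n\to\alpha_i$; also integers $0\le k_n\le n$ are given with $k_n/n\to\alpha$. For each $n$, $X_{1n},\dots,X_{Mn}$ are independent, $X_{in}$ being binomial with parameters $m_{in}$ and $p_i$ (the number of successes in block $i$ of a vector of $n$ independent Bernoulli variables, those in block $i$ having success probability $p_i$). Put $\Sigma_n:=\sum_{i=1}^M X_{in}$, so $\mathbb{E}(\Sigma_n)=\sum_i p_i m_{in}$. Only $n$ so large that $0<k_n<n$ and $0<m_{in}<n$ for all $i$ are considered. For such $n$, $c_{1n},\dots,c_{Mn}\in(0,1)$ denote the unique solution of the system $$\frac{1-c_{in}}{c_{in}}\frac{p_i}{1-p_i}=\frac{1-c_{jn}}{c_{jn}}\frac{p_j}{1-p_j}\ \ \forall i,j\in\{1,\dots,M\},\qquad \sum_{i=1}^M c_{in}m_{in}=k_n.$$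 One has $c_{in}\to c_i\in(0,1)$, where $c_i=\frac{p_i}{p_i+A(1-p_i)}$ and $A>0$ is the unique positive number with $\sum_{i=1}^M\frac{p_i\alpha_i}{p_i+A(1-p_i)}=\alpha$. Define the random vector $$\mathcal{X}_n:=\Bigl(\frac{X_{1n}-c_{1n}m_{1n}}{\sqrt n},\dots,\frac{X_{Mn}-c_{Mn}m_{Mn}}{\sqrt n}\Bigr).$$ Let $S_0:=\{z\in\mathbb{R}^M: z_1+\dots+z_M=0\}$, let $\nu_0(\cdot):=\lambda_0(\cdot\cap S_0)$ on the Borel sets of $\mathbb{R}^M$, where $\lambda_0$ is $(M-1)$-dimensional Lebesgue measure on $S_0$, and let $$f(z)=\mathbf{1}_{S_0}(z)\prod_{i=1}^M\exp\Bigl(-\frac{z_i^2}{2c_i(1-c_i)\alpha_i}\Bigr),\qquad z\in\mathbb{R}^M.$$ *)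

theory Defs
  imports "HOL-Probability.Probability"
begin

text \<open>
  The type \<open>'m\<close> indexes the \<open>M = CARD('m)\<close> blocks.
  \<open>block_probs p m k\<close> is the vector \<open>(c\<^sub>1, \<dots>, c\<^sub>M)\<close> for success probabilities \<open>p\<close>, block sizes
  \<open>m\<close> and level \<open>k\<close>; it is meaningful when all \<open>p i\<close> lie in \<open>(0,1)\<close>, all \<open>m i > 0\<close> and
  \<open>0 < k < (\<Sum>i. m i)\<close>, see \<open>block_probs_ex1\<close> below.
\<close>

definition is_block_probs :: "('m::finite \<Rightarrow> real) \<Rightarrow> ('m \<Rightarrow> nat) \<Rightarrow> nat \<Rightarrow> ('m \<Rightarrow> real) \<Rightarrow> bool" where
  "is_block_probs p m k c \<longleftrightarrow>
     (\<forall>i. 0 < c i \<and> c i < 1) \<and>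
     (\<forall>i j. (1 - c i) / c i * (p i / (1 - p i)) = (1 - c j) / c j * (p j / (1 - p j))) \<and>
     (\<Sum>i\<in>UNIV. c i * real (m i)) = real k"

definition block_probs :: "('m::finite \<Rightarrow> real) \<Rightarrow> ('m \<Rightarrow> nat) \<Rightarrow> nat \<Rightarrow> 'm \<Rightarrow> real" where
  "block_probs p m k = (THE c. is_block_probs p m k c)"

definition tilt :: "('m::finite \<Rightarrow> real) \<Rightarrow> ('m \<Rightarrow> real) \<Rightarrow> real \<Rightarrow> real" where
  "tilt p \<alpha> a = (THE A. 0 < A \<and> (\<Sum>i\<in>UNIV. p i * \<alpha> i / (p i + A * (1 - p i))) = a)"

definition limit_probs :: "('m::finite \<Rightarrow> real) \<Rightarrow> ('m \<Rightarrow> real) \<Rightarrow> real \<Rightarrow> 'm \<Rightarrow> real" where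
  "limit_probs p \<alpha> a i = p i / (p i + tilt p \<alpha> a * (1 - p i))"

definition S0 :: "(real ^ 'm::finite) set" where
  "S0 = {z. (\<Sum>i\<in>UNIV. z $ i) = 0}"

text \<open>
  \<open>dim S\<close>-dimensional Lebesgue measure on a linear subspace \<open>S\<close>, extended by \<open>A \<mapsto> \<lambda>(A \<inter> S)\<close> to the
  Borel sets of the ambient space: the image of the product Lebesgue measure on \<open>\<real>\<^sup>B\<close>, for an
  orthonormal basis \<open>B\<close> of \<open>S\<close>, under the coordinate isometry. By orthogonal invariance of
  Lebesgue measure it does not depend on \<open>B\<close>. For \<open>S = {0}\<close> it is the point mass at \<open>0\<close>.
\<close>

definition orthonormal_basis_of :: "'a::euclidean_space set \<Rightarrow> 'a set \<Rightarrow> bool" where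
  "orthonormal_basis_of S B \<longleftrightarrow>
     B \<subseteq> S \<and> pairwise orthogonal B \<and> (\<forall>b\<in>B. norm b = 1) \<and> span B = S"

definition subspace_lborel :: "'a::euclidean_space set \<Rightarrow> 'a measure" where
  "subspace_lborel S =
     (let B = (SOME B. orthonormal_basis_of S B)
      in distr (\<Pi>\<^sub>M b\<in>B. (lborel :: real measure)) borel (\<lambda>x. \<Sum>b\<in>B. x b *\<^sub>R b))"

definition nu0 :: "(real ^ 'm::finite) measure" where
  "nu0 = subspace_lborel S0"

definition limit_fun :: "('m::finite \<Rightarrow> real) \<Rightarrow> ('m \<Rightarrow> real) \<Rightarrow> real ^ 'm \<Rightarrow> real" where
  "limit_fun c \<alpha> z = indicator S0 z * (\<Prod>i\<in>UNIV. exp (- ((z $ i)\<^sup>2 / (2 * c i * (1 - c i) * \<alpha> i))))"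

text \<open>Weak convergence of Borel probability measures; the library only covers measures on \<open>\<real>\<close>.\<close>

definition weakly_converges :: "(nat \<Rightarrow> 'a::metric_space measure) \<Rightarrow> 'a measure \<Rightarrow> bool" where
  "weakly_converges \<mu> \<nu> \<longleftrightarrow>
     (\<forall>g :: 'a \<Rightarrow> real. continuous_on UNIV g \<longrightarrow> bounded (range g) \<longrightarrow>
        (\<lambda>n. \<integral>x. g x \<partial>\<mu> n) \<longlonglongrightarrow> (\<integral>x. g x \<partial>\<nu>))"

text \<open>The objects selected by description above exist (and are unique).\<close>

lemma tilt_ex1:
  fixes p w :: "'m::finite \<Rightarrow> real"
  assumes p: "\<And>i. 0 < p i" "\<And>i. p i < 1" and w: "\<And>i. 0 < w i"
    and t: "0 < t" "t < (\<Sum>i\<in>UNIV. w i)"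
  shows "\<exists>!A. 0 < A \<and> (\<Sum>i\<in>UNIV. p i * w i / (p i + A * (1 - p i))) = t"
proof -
  define F where "F A = (\<Sum>i\<in>UNIV. p i * w i / (p i + A * (1 - p i)))" for A
  have den: "p i + A * (1 - p i) > 0" if "A \<ge> 0" for A i
    using p[of i] that by (simp add: add_pos_nonneg)
  have mono: "F B < F A" if "0 \<le> A" "A < B" for A B
    unfolding F_def
  proof (rule sum_strict_mono)
    fix i :: 'm
    have "p i + A * (1 - p i) < p i + B * (1 - p i)"
      using that p[of i] by simp
    then show "p i * w i / (p i + B * (1 - p i)) < p i * w i / (p i + A * (1 - p i))"
      using that p[of i] w[of i] den[of A i] den[of B i]
      by (intro divide_strict_left_mono mult_pos_pos) auto
  qed auto
  define C where "C = (\<Sum>i\<in>UNIV. p i * w i / (1 - p i))"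
  define K where "K = C / t"
  have C0: "C > 0"
    unfolding C_def using p w by (intro sum_pos) auto
  then have K: "K > 0" using t by (simp add: K_def)
  have "F K \<le> (\<Sum>i\<in>UNIV. p i * w i / (1 - p i) / K)"
    unfolding F_def
  proof (rule sum_mono)
    fix i :: 'm
    have "p i * w i / (p i + K * (1 - p i)) \<le> p i * w i / (K * (1 - p i))"
      using p[of i] w[of i] K den[of K i] by (intro divide_left_mono) auto
    then show "p i * w i / (p i + K * (1 - p i)) \<le> p i * w i / (1 - p i) / K"
      by (simp add: mult.commute)
  qed
  also have "\<dots> = C / K"
    by (simp only: C_def sum_divide_distrib)
  also have "\<dots> = t"
    using t C0 by (simp add: K_def)
  finally have "F K \<le> t" .
  moreover have F0: "F 0 > t"
    using t p by (simp add: F_def less_imp_neq[symmetric])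
  moreover have "continuous_on {0..K} F"
    unfolding F_def using den by (intro continuous_intros) (metis atLeastAtMost_iff less_irrefl)
  ultimately obtain A where A: "0 \<le> A" "F A = t"
    using IVT2'[of F K t 0] K by auto
  then have "A > 0" using F0 by (cases "A = 0") auto
  then show ?thesis
    unfolding F_def[symmetric] using A mono by (metis less_eq_real_def linorder_neqE not_less)
qed

lemma block_probs_ex1:
  fixes p :: "'m::finite \<Rightarrow> real"
  assumes p: "\<And>i. 0 < p i" "\<And>i. p i < 1" and m: "\<And>i. 0 < m i"
    and k: "0 < k" "k < (\<Sum>i\<in>UNIV. m i)"
  shows "\<exists>!c. is_block_probs p m k c"
proof -
  have "real k < (\<Sum>i\<in>UNIV. real (m i))" using k by (metis of_nat_less_iff of_nat_sum)
  then have ex1: "\<exists>!A. 0 < A \<and> (\<Sum>i\<in>UNIV. p i * real (m i) / (p i + A * (1 - p i))) = real k"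
    using p m k by (intro tilt_ex1) auto
  then obtain A where A: "0 < A" "(\<Sum>i\<in>UNIV. p i * real (m i) / (p i + A * (1 - p i))) = real k"
    by blast
  define c where "c i = p i / (p i + A * (1 - p i))" for i
  have odds: "(1 - c i) / c i * (p i / (1 - p i)) = A" for i
  proof -
    have "p i + A * (1 - p i) > 0" using p[of i] A by (simp add: add_pos_pos)
    then have "1 - c i = A * (1 - p i) / (p i + A * (1 - p i))"
      by (simp add: c_def diff_divide_eq_iff)
    with \<open>p i + A * (1 - p i) > 0\<close> show ?thesis using p[of i] by (simp add: c_def)
  qed
  have "is_block_probs p m k c"
    unfolding is_block_probs_def
  proof (intro conjI allI)
    fix i j
    have "A * (1 - p i) > 0" using p[of i] A by simp
    then show "0 < c i" "c i < 1" using p[of i] by (auto simp: c_def)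
    show "(1 - c i) / c i * (p i / (1 - p i)) = (1 - c j) / c j * (p j / (1 - p j))"
      by (simp only: odds)
    show "(\<Sum>i\<in>UNIV. c i * real (m i)) = real k" using A by (simp add: c_def)
  qed
  moreover have "d = c" if d: "is_block_probs p m k d" for d
  proof -
    define D where "D = (1 - d undefined) / d undefined * (p undefined / (1 - p undefined))"
    have d01: "0 < d i" "d i < 1" for i using d by (auto simp: is_block_probs_def)
    have "(1 - d i) / d i * (p i / (1 - p i)) = D" for i
      using d unfolding is_block_probs_def D_def by blast
    then have D: "(1 - d i) * p i = D * (d i * (1 - p i))" for i
      using d01[of i] p[of i] by (simp add: divide_eq_eq)
    have D0: "D > 0"
      unfolding D_def using d01[of undefined] p[of undefined] by simp
    have deq: "d i = p i / (p i + D * (1 - p i))" for i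
    proof -
      have "p i + D * (1 - p i) > 0" using p[of i] D0 by (simp add: add_pos_pos)
      moreover have "d i * (p i + D * (1 - p i)) = p i" using D[of i] by (simp add: algebra_simps)
      ultimately show ?thesis by (simp add: eq_divide_eq)
    qed
    have "(\<Sum>i\<in>UNIV. d i * real (m i)) = real k" using d by (simp add: is_block_probs_def)
    then have "(\<Sum>i\<in>UNIV. p i * real (m i) / (p i + D * (1 - p i))) = real k"
      by (simp add: deq)
    then have "D = A" using ex1 A D0 by blast
    then show ?thesis by (auto simp: c_def deq)
  qed
  ultimately show ?thesis by blast
qed

lemma orthonormal_basis_of_ex:
  fixes S :: "'a::euclidean_space set"
  assumes "subspace S"
  shows "\<exists>B. orthonormal_basis_of S B"
  using orthonormal_basis_subspace[OF assms] unfolding orthonormal_basis_of_def by metis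

end

theory Submission
  imports Defs
begin

text \<open>
  Tilting the success probabilities from \<open>p\<^sub>i\<close> to \<open>c\<^sub>i\<close> multiplies all odds by the same factor \<open>1 / A\<close>.
  Hence, up to a constant, the law of \<open>(X\<^sub>1, \<dots>, X\<^sub>M)\<close> on \<open>{\<Sigma> \<ge> k}\<close> gives \<open>y\<close> the weight
  \<open>A\<^bsup>\<Sigma>y - k\<^esup>\<close> times the product of the binomial \<open>(m\<^sub>i, c\<^sub>i)\<close> weights, which are centred on \<open>{\<Sigma> = k}\<close>;
  and \<open>k - E \<Sigma> \<le> (1 - A) n\<close> turns the hypothesis into \<open>\<surd>n (1 - A) \<longlonglongrightarrow> \<infinity>\<close>. So the overshoot
  \<open>\<Sigma>y - k\<close> is geometric on a scale \<open>o(\<surd>n)\<close> and disappears in the limit, while the binomial weights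
  become Gaussian. To make this precise, the sum over lattice points is written as an integral over
  \<open>\<real>\<^sup>M\<close>, one coordinate being an exponential variable that is rounded to the overshoot, and
  dominated convergence is applied. Only ratios of binomial weights to those near the mean enter, so
  no normalising constant (and no Stirling formula) is needed. The limit lives on \<open>S0\<close> parametrised
  by all coordinates but one, and the resulting measure is a multiple of \<open>nu0\<close> because both are
  invariant under translations from \<open>S0\<close>.
\<close>

section \<open>Translation-invariant measures on a subspace\<close>

text \<open>A conditional expectation is a quotient of two lattice sums, one with the test function
  and one with the constant 1. Whatever does not depend on the lattice point occurs in both and
  cancels.

  Passing to an integral gives the convergence a fixed space: the lattice, the level
  \<open>k n\<close> and the geometric parameter \<open>A n\<close> all move with n, while the
  exponential density and the majorant do not.

  Two estimates of binomial ratios are needed because they have different jobs. Pointwise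
  convergence requires the sharp Gaussian exponent, but only for displacements of order sqrt m.
  Domination requires all displacements, but any Gaussian will do.

  The cases in which \<open>A n\<close> tends to 1 or to a limit below 1 are not separated. The
  overshoot is geometric on the scale \<open>1 / - ln (A n)\<close>, which may be bounded or may
  diverge; only its being small against sqrt n enters.\<close>

lemma sigma_finite_measure_cball:
  fixes \<mu> :: "'a::euclidean_space measure"
  assumes [simp]: "sets \<mu> = sets borel"
    and "\<And>R. emeasure \<mu> (cball 0 R) \<noteq> \<infinity>"
  shows "sigma_finite_measure \<mu>"
proof
  have "space \<mu> = UNIV"
    using sets_eq_imp_space_eq[OF assms(1)] by simp
  moreover have "x \<in> (\<Union>n. cball 0 (real n))" for x :: 'a
    using real_arch_simple[of "norm x"] by auto
  ultimately show "\<exists>A. countable A \<and> A \<subseteq> sets \<mu> \<and> \<Union> A = space \<mu> \<and> (\<forall>a\<in>A. emeasure \<mu> a \<noteq> \<infinity>)"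
    using assms(2) by (intro exI[of _ "range (\<lambda>n. cball 0 (real n))"]) auto
qed

text \<open>The uniqueness proof for Haar measure; the ball, being symmetric, makes inversion harmless.\<close>

lemma nn_integral_subspace_invariant_proportional:
  fixes \<mu> \<nu> :: "'a::euclidean_space measure"
  assumes S: "subspace S"
    and sets [measurable_cong]: "sets \<mu> = sets borel" "sets \<nu> = sets borel"
    and fin: "\<And>R. emeasure \<mu> (cball 0 R) \<noteq> \<infinity>" "\<And>R. emeasure \<nu> (cball 0 R) \<noteq> \<infinity>"
    and conc: "AE x in \<mu>. x \<in> S" "AE x in \<nu>. x \<in> S"
    and inv: "\<And>s. s \<in> S \<Longrightarrow> distr \<mu> borel ((+) s) = \<mu>" "\<And>s. s \<in> S \<Longrightarrow> distr \<nu> borel ((+) s) = \<nu>"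
    and f [measurable]: "f \<in> borel_measurable borel"
  shows "(\<integral>\<^sup>+x. f x \<partial>\<mu>) * emeasure \<nu> (cball 0 R) = (\<integral>\<^sup>+x. f x \<partial>\<nu>) * emeasure \<mu> (cball 0 R)"
proof -
  interpret \<mu>: sigma_finite_measure \<mu> by (rule sigma_finite_measure_cball) fact+
  interpret \<nu>: sigma_finite_measure \<nu> by (rule sigma_finite_measure_cball) fact+
  interpret pair_sigma_finite \<mu> \<nu> ..
  define g :: "'a \<Rightarrow> ennreal" where "g = indicator (cball 0 R)"
  have g [measurable]: "g \<in> borel_measurable borel"
    unfolding g_def by (rule borel_measurable_indicator) simp
  have sym: "g (- x) = g x" for x by (simp add: g_def indicator_def)
  have shift: "(\<integral>\<^sup>+x. h x \<partial>\<mu>) = (\<integral>\<^sup>+x. h (s + x) \<partial>\<mu>)" "(\<integral>\<^sup>+x. h x \<partial>\<nu>) = (\<integral>\<^sup>+x. h (s + x) \<partial>\<nu>)"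
    if "s \<in> S" and [measurable]: "h \<in> borel_measurable borel" for h :: "'a \<Rightarrow> ennreal" and s
    using nn_integral_distr[of "(+) s" \<mu> borel h] nn_integral_distr[of "(+) s" \<nu> borel h]
    by (simp_all add: inv[OF that(1)])
  have int_g: "(\<integral>\<^sup>+x. g x \<partial>\<mu>) = emeasure \<mu> (cball 0 R)" "(\<integral>\<^sup>+x. g x \<partial>\<nu>) = emeasure \<nu> (cball 0 R)"
    unfolding g_def by (simp_all add: sets)
  have "(\<integral>\<^sup>+x. f x \<partial>\<mu>) * emeasure \<nu> (cball 0 R) = (\<integral>\<^sup>+y. (\<integral>\<^sup>+x. f x \<partial>\<mu>) * g y \<partial>\<nu>)"
    by (simp add: nn_integral_cmult int_g)
  also have "\<dots> = (\<integral>\<^sup>+y. (\<integral>\<^sup>+x. f (y + x) * g y \<partial>\<mu>) \<partial>\<nu>)"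
  proof (rule nn_integral_cong_AE, use conc(2) in eventually_elim)
    case (elim y)
    then show ?case
      using shift(1)[of y f] by (simp add: nn_integral_multc)
  qed
  also have "\<dots> = (\<integral>\<^sup>+x. (\<integral>\<^sup>+y. f (y + x) * g y \<partial>\<nu>) \<partial>\<mu>)"
    by (rule Fubini') measurable
  \<comment> \<open>Substituting \<open>y - x\<close> for \<open>y\<close> moves the shift from
    \<open>f\<close> to \<open>g\<close>, so that the next swap isolates an integral of
    \<open>g\<close> under \<open>\<mu>\<close>.\<close>
  also have "\<dots> = (\<integral>\<^sup>+x. (\<integral>\<^sup>+y. f y * g (y - x) \<partial>\<nu>) \<partial>\<mu>)"
  proof (rule nn_integral_cong_AE, use conc(1) in eventually_elim)
    case (elim x)
    have "(\<integral>\<^sup>+y. f y * g (y - x) \<partial>\<nu>) = (\<integral>\<^sup>+y. f (x + y) * g (x + y - x) \<partial>\<nu>)"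
      by (rule shift(2)) (use elim in auto)
    then show ?case by (simp add: add.commute)
  qed
  also have "\<dots> = (\<integral>\<^sup>+y. (\<integral>\<^sup>+x. f y * g (y - x) \<partial>\<mu>) \<partial>\<nu>)"
    by (rule Fubini'[symmetric]) measurable
  also have "\<dots> = (\<integral>\<^sup>+y. f y * emeasure \<mu> (cball 0 R) \<partial>\<nu>)"
  proof (rule nn_integral_cong_AE, use conc(2) in eventually_elim)
    case (elim y)
    have "(\<integral>\<^sup>+x. f y * g (y - x) \<partial>\<mu>) = f y * (\<integral>\<^sup>+x. g (y - x) \<partial>\<mu>)"
      by (rule nn_integral_cmult) measurable
    also have "(\<integral>\<^sup>+x. g (y - x) \<partial>\<mu>) = (\<integral>\<^sup>+x. g (- y + x) \<partial>\<mu>)"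
      by (subst sym[symmetric]) simp
    also have "\<dots> = emeasure \<mu> (cball 0 R)"
      unfolding int_g[symmetric]
      by (rule shift(1)[symmetric]) (use elim S in \<open>auto simp: subspace_neg\<close>)
    finally show ?case .
  qed
  finally show ?thesis by (simp add: nn_integral_multc)
qed

text \<open>Covers two parametrisations of \<open>S0\<close> at once: an orthonormal basis indexed
  by itself (\<open>v = id\<close>), which gives \<open>nu0\<close>, and the oblique chart by the
  coordinates other than \<open>i0\<close>. Comparing them by invariance replaces the determinant of
  a change of variables.\<close>

definition param_lborel :: "'i set \<Rightarrow> ('i \<Rightarrow> 'a::euclidean_space) \<Rightarrow> 'a measure" where
  "param_lborel I v = distr (\<Pi>\<^sub>M i\<in>I. (lborel :: real measure)) borel (\<lambda>x. \<Sum>i\<in>I. x i *\<^sub>R v i)"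

lemma sets_param_lborel [simp, measurable_cong]: "sets (param_lborel I v) = sets borel"
  by (simp add: param_lborel_def)

interpretation product_lborel: product_sigma_finite "\<lambda>_. lborel :: real measure"
  by unfold_locales

lemma distr_PiM_lborel_translate:
  assumes "finite I"
  shows "distr (\<Pi>\<^sub>M i\<in>I. (lborel :: real measure)) (\<Pi>\<^sub>M i\<in>I. lborel) (\<lambda>x. \<lambda>i\<in>I. t i + x i) = (\<Pi>\<^sub>M i\<in>I. lborel)"
proof (rule product_lborel.PiM_eqI[OF assms])
  let ?M = "\<Pi>\<^sub>M i\<in>I. (lborel :: real measure)"
  fix A :: "'a \<Rightarrow> real set"
  assume A: "\<And>i. i \<in> I \<Longrightarrow> A i \<in> sets lborel"
  have B: "(+) (t i) -` A i \<in> sets lborel" if "i \<in> I" for i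
    using measurable_sets[of "(+) (t i)" lborel lborel "A i"] A[OF that] by auto
  have "emeasure (distr ?M ?M (\<lambda>x. \<lambda>i\<in>I. t i + x i)) (Pi\<^sub>E I A) =
      emeasure ?M ((\<lambda>x. \<lambda>i\<in>I. t i + x i) -` Pi\<^sub>E I A \<inter> space ?M)"
    using A assms by (intro emeasure_distr sets_PiM_I_finite) auto
  also have "(\<lambda>x. \<lambda>i\<in>I. t i + x i) -` Pi\<^sub>E I A \<inter> space ?M = Pi\<^sub>E I (\<lambda>i. (+) (t i) -` A i)"
    by (auto simp: space_PiM PiE_iff)
  also have "emeasure ?M \<dots> = (\<Prod>i\<in>I. emeasure lborel ((+) (t i) -` A i))"
    using B assms by (intro product_lborel.emeasure_PiM) auto
  also have "\<dots> = (\<Prod>i\<in>I. emeasure lborel (A i))"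
  proof (rule prod.cong[OF refl])
    fix i assume i: "i \<in> I"
    have "emeasure lborel (A i) = emeasure (distr lborel borel ((+) (t i))) (A i)"
      by (simp only: lborel_distr_plus)
    also have "\<dots> = emeasure lborel ((+) (t i) -` A i)"
      using A[OF i] by (subst emeasure_distr) auto
    finally show "emeasure lborel ((+) (t i) -` A i) = emeasure lborel (A i)" by simp
  qed
  finally show "emeasure (distr ?M ?M (\<lambda>x. \<lambda>i\<in>I. t i + x i)) (Pi\<^sub>E I A) = (\<Prod>i\<in>I. emeasure lborel (A i))" .
qed simp

text \<open>A shift by a vector of the span lifts to a shift of the coordinates, under which product
  Lebesgue measure is invariant.\<close>

lemma distr_param_lborel_translate:
  assumes "finite I" and s: "s \<in> span (v ` I)"
  shows "distr (param_lborel I v) borel ((+) s) = param_lborel I v"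
proof -
  let ?M = "\<Pi>\<^sub>M i\<in>I. (lborel :: real measure)"
  \<comment> \<open>Going through a subspace yields coefficients indexed by \<open>I\<close> itself,
    although \<open>v\<close> may repeat vectors.\<close>
  have "subspace (range (\<lambda>t. \<Sum>i\<in>I. t i *\<^sub>R v i))"
  proof (rule subspaceI)
    show "0 \<in> range (\<lambda>t. \<Sum>i\<in>I. t i *\<^sub>R v i)"
      by (rule range_eqI[of _ _ "\<lambda>_. 0"]) simp
  next
    fix x y assume "x \<in> range (\<lambda>t. \<Sum>i\<in>I. t i *\<^sub>R v i)" "y \<in> range (\<lambda>t. \<Sum>i\<in>I. t i *\<^sub>R v i)"
    then obtain t t' where "x = (\<Sum>i\<in>I. t i *\<^sub>R v i)" "y = (\<Sum>i\<in>I. t' i *\<^sub>R v i)" by auto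
    then show "x + y \<in> range (\<lambda>t. \<Sum>i\<in>I. t i *\<^sub>R v i)"
      by (intro range_eqI[of _ _ "\<lambda>i. t i + t' i"]) (simp add: sum.distrib scaleR_add_left)
  next
    fix c x assume "x \<in> range (\<lambda>t. \<Sum>i\<in>I. t i *\<^sub>R v i)"
    then obtain t where "x = (\<Sum>i\<in>I. t i *\<^sub>R v i)" by auto
    then show "c *\<^sub>R x \<in> range (\<lambda>t. \<Sum>i\<in>I. t i *\<^sub>R v i)"
      by (intro range_eqI[of _ _ "\<lambda>i. c * t i"]) (simp add: scaleR_sum_right)
  qed
  moreover have "v j = (\<Sum>i\<in>I. (if i = j then 1 else 0) *\<^sub>R v i)" if "j \<in> I" for j
    using that \<open>finite I\<close> by (simp add: if_distrib[where f = "\<lambda>c. c *\<^sub>R _"] cong: if_cong)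
  ultimately have "span (v ` I) \<subseteq> range (\<lambda>t. \<Sum>i\<in>I. t i *\<^sub>R v i)"
    by (intro span_minimal image_subsetI) (simp_all add: range_eqI)
  then obtain t where t: "s = (\<Sum>i\<in>I. t i *\<^sub>R v i)"
    using s by auto
  have "distr (param_lborel I v) borel ((+) s) = distr ?M borel (\<lambda>x. s + (\<Sum>i\<in>I. x i *\<^sub>R v i))"
    unfolding param_lborel_def by (subst distr_distr) (auto simp: o_def)
  also have "\<dots> = distr ?M borel ((\<lambda>x. \<Sum>i\<in>I. x i *\<^sub>R v i) \<circ> (\<lambda>x. \<lambda>i\<in>I. t i + x i))"
    by (intro distr_cong) (auto simp: t sum.distrib scaleR_add_left)
  also have "\<dots> = distr (distr ?M ?M (\<lambda>x. \<lambda>i\<in>I. t i + x i)) borel (\<lambda>x. \<Sum>i\<in>I. x i *\<^sub>R v i)"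
    by (subst distr_distr) auto
  finally show ?thesis
    unfolding distr_PiM_lborel_translate[OF \<open>finite I\<close>] param_lborel_def .
qed

lemma AE_param_lborel_span: "AE x in param_lborel I v. x \<in> span (v ` I)"
  unfolding param_lborel_def
  by (subst AE_distr_iff) (simp_all add: span_sum span_scale span_base)

text \<open>The dual vectors \<open>w\<close> read off the coordinates as inner products, so the
  preimage of a ball lies in a box of finite volume. Conversely a small box around 0 is mapped into
  the unit ball.\<close>

lemma emeasure_param_lborel_cball:
  fixes v w :: "'i \<Rightarrow> 'a::euclidean_space"
  assumes I: "finite I" and biorth: "\<And>i j. i \<in> I \<Longrightarrow> j \<in> I \<Longrightarrow> v i \<bullet> w j = (if i = j then 1 else 0)"
  shows "emeasure (param_lborel I v) (cball 0 R) \<noteq> \<infinity>"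
    and "0 < emeasure (param_lborel I v) (cball 0 1)"
proof -
  let ?M = "\<Pi>\<^sub>M i\<in>I. (lborel :: real measure)" and ?T = "\<lambda>x. \<Sum>i\<in>I. x i *\<^sub>R v i"
  have eq: "emeasure (param_lborel I v) (cball 0 R) = emeasure ?M (?T -` cball 0 R \<inter> space ?M)" for R
    unfolding param_lborel_def by (rule emeasure_distr) auto
  have meas: "?T -` cball 0 R \<inter> space ?M \<in> sets ?M" for R by measurable
  have "\<bar>x j\<bar> \<le> R * norm (w j)" if "norm (?T x) \<le> R" "j \<in> I" for x j
  proof -
    have "?T x \<bullet> w j = (\<Sum>i\<in>I. if i = j then x i else 0)"
      unfolding inner_sum_left using that(2) by (intro sum.cong) (auto simp: biorth)
    also have "\<dots> = x j" using that(2) I by simp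
    finally have "\<bar>x j\<bar> \<le> norm (?T x) * norm (w j)"
      using Cauchy_Schwarz_ineq2[of "?T x" "w j"] by simp
    also have "\<dots> \<le> R * norm (w j)" using that(1) by (intro mult_right_mono) auto
    finally show ?thesis .
  qed
  then have "?T -` cball 0 R \<inter> space ?M \<subseteq> Pi\<^sub>E I (\<lambda>j. {- (R * norm (w j))..R * norm (w j)})"
    by (auto simp: space_PiM PiE_iff abs_le_iff minus_le_iff)
  then have "emeasure (param_lborel I v) (cball 0 R)
      \<le> emeasure ?M (Pi\<^sub>E I (\<lambda>j. {- (R * norm (w j))..R * norm (w j)}))"
    unfolding eq using I by (intro emeasure_mono sets_PiM_I_finite) auto
  also have "\<dots> = (\<Prod>j\<in>I. emeasure lborel {- (R * norm (w j))..R * norm (w j)})"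
    using I by (intro product_lborel.emeasure_PiM) auto
  also have "\<dots> < \<infinity>" using I by (auto simp: ennreal_prod_eq_top less_top[symmetric] emeasure_lborel_Icc_eq)
  finally show "emeasure (param_lborel I v) (cball 0 R) \<noteq> \<infinity>" by simp
  \<comment> \<open>Half side for which the triangle inequality puts the box into the unit ball; the
    summand 1 guards against a vanishing sum.\<close>
  define d where "d = 1 / (1 + (\<Sum>i\<in>I. norm (v i)))"
  have V: "0 \<le> (\<Sum>i\<in>I. norm (v i))" by (intro sum_nonneg) auto
  then have "d > 0" by (simp add: d_def add_pos_nonneg)
  have "norm (?T x) \<le> 1" if "\<And>i. i \<in> I \<Longrightarrow> \<bar>x i\<bar> \<le> d" for x
  proof -
    have "norm (?T x) \<le> (\<Sum>i\<in>I. d * norm (v i))"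
      using that by (intro sum_norm_le) (auto intro: mult_right_mono)
    also have "\<dots> \<le> 1" unfolding sum_distrib_left[symmetric] using V by (simp add: d_def)
    finally show ?thesis .
  qed
  then have "Pi\<^sub>E I (\<lambda>_. {-d..d}) \<subseteq> ?T -` cball 0 1 \<inter> space ?M"
    by (auto simp: space_PiM PiE_iff abs_le_iff minus_le_iff)
  then have "emeasure ?M (Pi\<^sub>E I (\<lambda>_. {-d..d})) \<le> emeasure (param_lborel I v) (cball 0 1)"
    unfolding eq using meas by (intro emeasure_mono) auto
  moreover have "emeasure ?M (Pi\<^sub>E I (\<lambda>_. {-d..d})) = (\<Prod>i\<in>I. ennreal (2 * d))"
    using I \<open>d > 0\<close> by (subst product_lborel.emeasure_PiM) auto
  moreover have "0 < (\<Prod>i\<in>I. ennreal (2 * d))"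
    using \<open>d > 0\<close> I by (auto simp: zero_less_iff_neq_zero)
  ultimately show "0 < emeasure (param_lborel I v) (cball 0 1)" by simp
qed

text \<open>The unit ball has positive finite mass under both measures, so \<open>C\<close> is the
  quotient of the two masses.\<close>

lemma param_lborel_proportional:
  fixes v w :: "'i \<Rightarrow> 'a::euclidean_space" and v' w' :: "'j \<Rightarrow> 'a"
  assumes I: "finite I" "\<And>i j. i \<in> I \<Longrightarrow> j \<in> I \<Longrightarrow> v i \<bullet> w j = (if i = j then 1 else 0)"
    and J: "finite J" "\<And>i j. i \<in> J \<Longrightarrow> j \<in> J \<Longrightarrow> v' i \<bullet> w' j = (if i = j then 1 else 0)"
    and span: "span (v ` I) = span (v' ` J)"
  obtains C where "0 < C" "param_lborel I v = scale_measure (ennreal C) (param_lborel J v')"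
proof -
  let ?\<mu> = "param_lborel I v" and ?\<nu> = "param_lborel J v'"
  have fin_pos: "\<exists>a>0. e = ennreal a" if "e \<noteq> \<infinity>" "0 < e" for e
    using that by (cases e) auto
  obtain a where a: "a > 0" "emeasure ?\<mu> (cball 0 1) = ennreal a"
    using fin_pos[OF emeasure_param_lborel_cball[OF I]] by blast
  obtain b where b: "b > 0" "emeasure ?\<nu> (cball 0 1) = ennreal b"
    using fin_pos[OF emeasure_param_lborel_cball[OF J]] by blast
  have "emeasure ?\<mu> A = emeasure (scale_measure (ennreal (a / b)) ?\<nu>) A" if "A \<in> sets borel" for A
  proof -
    have "(\<integral>\<^sup>+x. indicator A x \<partial>?\<mu>) * emeasure ?\<nu> (cball 0 1)
        = (\<integral>\<^sup>+x. indicator A x \<partial>?\<nu>) * emeasure ?\<mu> (cball 0 1)"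
      using emeasure_param_lborel_cball(1)[OF I] emeasure_param_lborel_cball(1)[OF J]
        AE_param_lborel_span[where I = I and v = v] AE_param_lborel_span[where I = J and v = v'] I(1) J(1) that
      by (intro nn_integral_subspace_invariant_proportional[of "span (v ` I)"])
         (auto simp: span distr_param_lborel_translate)
    then have "emeasure ?\<mu> A * ennreal b = emeasure ?\<nu> A * ennreal a"
      using that by (simp add: a b)
    then have "emeasure ?\<mu> A * (ennreal b * ennreal (1 / b)) = emeasure ?\<nu> A * (ennreal a * ennreal (1 / b))"
      by (simp add: mult.assoc[symmetric])
    then show ?thesis
      using a b by (simp add: ennreal_mult[symmetric] mult.commute)
  qed
  then have "?\<mu> = scale_measure (ennreal (a / b)) ?\<nu>"
    by (intro measure_eqI) auto
  with a b show thesis by (intro that[of "a / b"]) auto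
qed

text \<open>Whatever basis the choice in \<open>subspace_lborel\<close> returns, it is orthonormal
  and hence its own dual system; the chart vectors have the dual system \<open>axis j 1\<close>. The
  value of \<open>C\<close> can stay undetermined, as it cancels in the normalised density.\<close>

lemma nu0_proportional:
  fixes i0 :: "'m::finite"
  obtains C where "0 < C"
    "(nu0 :: (real ^ 'm) measure) = scale_measure (ennreal C) (param_lborel (- {i0}) (\<lambda>i. axis i 1 - axis i0 1))"
proof -
  define v :: "'m \<Rightarrow> real ^ 'm" where "v i = axis i 1 - axis i0 1" for i
  define B :: "(real ^ 'm) set" where "B = (SOME B. orthonormal_basis_of S0 B)"
  have sub: "subspace (S0 :: (real ^ 'm) set)"
    by (auto simp: subspace_def S0_def sum.distrib sum_distrib_left[symmetric])
  have B: "orthonormal_basis_of S0 B"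
    unfolding B_def by (rule someI_ex) (rule orthonormal_basis_of_ex[OF sub])
  have "finite B" using B
    by (metis (no_types, lifting) norm_zero orthonormal_basis_of_def pairwise_orthogonal_imp_finite)
  have biorth_B: "id b \<bullet> id b' = (if b = b' then 1 else 0)" if "b \<in> B" "b' \<in> B" for b b'
    using B that by (auto simp: orthonormal_basis_of_def pairwise_def orthogonal_def norm_eq_1)
  have biorth_v: "v i \<bullet> axis j 1 = (if i = j then 1 else 0)" if "i \<in> - {i0}" "j \<in> - {i0}" for i j
    using that by (auto simp: v_def inner_diff_left inner_axis_axis)
  have "z \<in> span (v ` (- {i0}))" if "z \<in> S0" for z
  proof -
    have "z $ i0 = - (\<Sum>i\<in>- {i0}. z $ i)"
      using that sum.remove[of UNIV i0 "($) z"] by (simp add: S0_def Compl_eq_Diff_UNIV)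
    moreover have "z $ i * v i $ j = (if i = j then z $ i else 0)" if "j \<noteq> i0" for i j
      using that by (auto simp: v_def axis_def)
    moreover have "v i $ i0 = - 1" if "i \<noteq> i0" for i
      using that by (simp add: v_def axis_def)
    ultimately have "z $ j = (\<Sum>i\<in>- {i0}. z $ i *\<^sub>R v i) $ j" for j
      by (cases "j = i0") (simp_all add: sum_negf)
    then have "z = (\<Sum>i\<in>- {i0}. z $ i *\<^sub>R v i)"
      unfolding vec_eq_iff by blast
    also have "\<dots> \<in> span (v ` (- {i0}))"
      by (intro span_sum span_scale span_base imageI)
    finally show ?thesis .
  qed
  moreover have "v i \<in> S0" for i by (simp add: v_def S0_def axis_def sum_subtractf)
  ultimately have "span (v ` (- {i0})) = S0"
    by (intro subset_antisym span_minimal sub) auto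
  then have span: "span (id ` B) = span (v ` (- {i0}))"
    using B by (simp add: orthonormal_basis_of_def)
  have "nu0 = param_lborel B id"
    by (simp add: nu0_def subspace_lborel_def param_lborel_def B_def Let_def)
  with param_lborel_proportional[of B id id "- {i0}" v "\<lambda>j. axis j 1",
      OF \<open>finite B\<close> biorth_B finite biorth_v span] that
  show thesis unfolding v_def by metis
qed

section \<open>Ratios of binomial weights\<close>

text \<open>Binomial weights, extended by \<open>0\<close> to all integers so that reflection and shifts need no side
  conditions.\<close>

definition binw :: "nat \<Rightarrow> real \<Rightarrow> int \<Rightarrow> real" where
  "binw m c y = (if 0 \<le> y then real (m choose nat y) * c ^ nat y * (1 - c) ^ (m - nat y) else 0)"

lemma binw_nonneg: "0 \<le> c \<Longrightarrow> c \<le> 1 \<Longrightarrow> 0 \<le> binw m c y"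
  by (simp add: binw_def)

lemma binw_pos:
  assumes "0 < c" "c < 1" "0 \<le> y" "y \<le> int m"
  shows "0 < binw m c y"
proof -
  have "nat y \<le> m" using assms by linarith
  then show ?thesis using assms by (simp add: binw_def)
qed

lemma binw_eq_0: "y < 0 \<or> int m < y \<Longrightarrow> binw m c y = 0"
  using nat_less_iff[of y m] by (auto simp: binw_def not_less[symmetric])

text \<open>Exchanging successes and failures turns estimates for upward displacements into
  estimates for downward ones.\<close>

lemma binw_reflect: "binw m (1 - c) (int m - y) = binw m c y"
proof (cases "0 \<le> y \<and> y \<le> int m")
  case True
  then obtain l where l: "y = int l" "l \<le> m" by (metis nonneg_int_cases of_nat_le_iff)
  then have "nat (int m - y) = m - l" by simp
  with l show ?thesis by (simp add: binw_def binomial_symmetric[symmetric] mult.commute)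
next
  case False
  then show ?thesis by (auto simp: binw_eq_0)
qed

lemma binw_Suc:
  assumes "0 \<le> y" "y < int m"
  shows "binw m c (y + 1) * ((y + 1) * (1 - c)) = binw m c y * ((real m - y) * c)"
proof -
  obtain l where l: "y = int l" "l < m" using assms by (metis nonneg_int_cases of_nat_less_iff)
  then obtain r where r: "m = Suc (l + r)" using less_iff_Suc_add by blast
  have "Suc l * (m choose Suc l) = (m - l) * (m choose l)"
    by (simp only: binomial_absorption binomial_absorb_comp)
  then have "real (Suc l) * real (m choose Suc l) = real (m - l) * real (m choose l)"
    by (metis of_nat_mult)
  then have "(real l + 1) * real (m choose Suc l) = (real m - l) * real (m choose l)"
    using l by (simp add: of_nat_diff add.commute)
  moreover have "(1 - c) ^ (m - l) = (1 - c) * (1 - c) ^ (m - Suc l)"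
    by (simp add: r Suc_diff_le)
  moreover have "nat (1 + int l) = Suc l" by simp
  ultimately show ?thesis
    unfolding binw_def l by (simp add: mult_ac add.commute)
qed

text \<open>The step from \<open>j\<close> to \<open>j + 1\<close> multiplies the weight by at most
  \<open>exp (1 / (m * (1 - c)) - j / m)\<close>, by way of \<open>1 + x \<le> exp x\<close>. The
  exponents add up to the triangular number \<open>j * (j - 1) / 2\<close> over \<open>m\<close>,
  however large \<open>j\<close> is.\<close>

lemma binw_up_le:
  assumes c: "0 < c" "c < 1" and m: "0 < m" and y: "0 \<le> y" "y \<le> int m"
    and near: "\<bar>real_of_int y - c * m\<bar> \<le> 1"
  shows "binw m c (y + int j) \<le> binw m c y * exp (j / (real m * (1 - c)) - real j * (real j - 1) / (2 * real m))"
proof (induction j)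
  case (Suc j)
  have step: "(j / (M * d) - real j * (real j - 1) / (2 * M)) + (1 / (M * d) - j / M)
      = Suc j / (M * d) - real (Suc j) * (real (Suc j) - 1) / (2 * M)" if "M \<noteq> 0" "d \<noteq> 0" for M d :: real
    using that by (simp add: field_simps)
  have pos: "0 \<le> binw m c z" for z using c by (simp add: binw_nonneg)
  show ?case
  proof (cases "y + int j < int m")
    case False
    then show ?thesis using pos by (simp add: binw_eq_0)
  next
    case True
    define \<theta> where "\<theta> = c * m - y"
    have \<theta>: "\<bar>\<theta>\<bar> \<le> 1" using near by (simp add: \<theta>_def abs_minus_commute)
    define x where "x = (\<theta> - j) / (real m * (1 - c))"
    define D where "D = (real_of_int y + j + 1) * (1 - c)"
    have Y: "0 < real_of_int y + j + 1" using y by simp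
    then have "D > 0" using c by (simp add: D_def)
    have num: "0 \<le> real m - y - j" using True by linarith
    have x1: "1 + x = (real m - y - j) / (real m * (1 - c))"
      using c m by (simp add: x_def \<theta>_def field_simps)
    \<comment> \<open>\<open>\<theta> \<le> 1\<close> means \<open>c * m \<le> y + 1\<close>, so
      \<open>c * m\<close> may replace the denominator \<open>y + j + 1\<close> of the ratio; what
      remains is linear in \<open>j\<close>.\<close>
    have "(real m - y - j) * c * m \<le> (real m - y - j) * (real_of_int y + j + 1)"
      unfolding mult.assoc using \<theta> by (intro mult_left_mono num) (simp add: \<theta>_def)
    then have "(real m - y - j) * c / (real_of_int y + j + 1) \<le> (real m - y - j) / m"
      using Y m by (simp add: divide_simps mult_ac)
    then have "(real m - y - j) * c / (real_of_int y + j + 1) / (1 - c) \<le> (real m - y - j) / m / (1 - c)"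
      using c by (intro divide_right_mono) auto
    then have "(real m - y - j) * c / D \<le> 1 + x"
      unfolding x1 D_def by simp
    also have "\<dots> \<le> exp x" by (rule exp_ge_add_one_self)
    also have "x \<le> 1 / (real m * (1 - c)) - j / m"
    proof -
      have "x \<le> (1 - real j) / (real m * (1 - c))"
        unfolding x_def using \<theta> c m by (intro divide_right_mono) auto
      also have "\<dots> = 1 / (real m * (1 - c)) - j / (real m * (1 - c))" by (simp add: diff_divide_distrib)
      also have "\<dots> \<le> 1 / (real m * (1 - c)) - j / m"
        using c m by (intro diff_left_mono divide_left_mono) (auto simp: mult_le_cancel_left1)
      finally show ?thesis .
    qed
    finally have R: "(real m - y - j) * c / D \<le> exp (1 / (real m * (1 - c)) - j / m)" by simp
    have "binw m c (y + int (Suc j)) * D = binw m c (y + int j) * ((real m - y - j) * c)"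
      using binw_Suc[of "y + int j" m c] y True by (simp add: D_def algebra_simps)
    then have "binw m c (y + int (Suc j)) = binw m c (y + int j) * ((real m - y - j) * c / D)"
      using \<open>D > 0\<close> by (simp add: field_simps)
    also have "\<dots> \<le> (binw m c y * exp (j / (real m * (1 - c)) - real j * (real j - 1) / (2 * real m)))
        * exp (1 / (real m * (1 - c)) - j / m)"
      using Suc.IH R pos num c \<open>D > 0\<close> by (intro mult_mono) auto
    also have "\<dots> = binw m c y * exp (Suc j / (real m * (1 - c)) - real (Suc j) * (real (Suc j) - 1) / (2 * real m))"
      using step[of "real m" "1 - c"] m c by (simp add: exp_add[symmetric])
    finally show ?thesis .
  qed
qed simp

text \<open>For \<open>j \<le> m\<close> the terms of the exponent that are linear in
  \<open>j\<close> are bounded by a constant; for larger \<open>j\<close> the weight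
  vanishes.\<close>

lemma binw_up_gauss:
  assumes c: "0 < c" "c < 1" and m: "0 < m" and y: "0 \<le> y" "y \<le> int m"
    and near: "\<bar>real_of_int y - c * m\<bar> \<le> 1"
  shows "binw m c (y + int j) \<le> binw m c y * (exp (1 / (1 - c) + 1) * exp (- (real j)\<^sup>2 / (2 * real m)))"
proof (cases "j \<le> m")
  case True
  have "j / (real m * (1 - c)) \<le> m / (real m * (1 - c))"
    using True c by (intro divide_right_mono) auto
  then have "j / (real m * (1 - c)) \<le> 1 / (1 - c)" using m by simp
  moreover have "real j * (real j - 1) / (2 * real m) = (real j)\<^sup>2 / (2 * real m) - j / (2 * real m)"
    by (simp add: right_diff_distrib diff_divide_distrib power2_eq_square)
  moreover have "j / (2 * real m) \<le> 1" using True m by simp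
  ultimately have "j / (real m * (1 - c)) - real j * (real j - 1) / (2 * real m) \<le> 1 / (1 - c) + 1 + - (real j)\<^sup>2 / (2 * real m)"
    by simp
  then show ?thesis
    using binw_up_le[OF assms, of j] binw_nonneg[of c m y] c
    by (smt (verit, best) exp_add exp_le_cancel_iff mult_left_mono)
next
  case False
  then show ?thesis using y c by (simp add: binw_eq_0 binw_nonneg)
qed

text \<open>Meant as a majorant, for which the exponent with \<open>2 * m\<close> instead of the
  sharp \<open>2 * m * c * (1 - c)\<close> is good enough. Reflection swaps \<open>c\<close> and
  \<open>1 - c\<close>; the constant accommodates both.\<close>

lemma binw_gauss:
  fixes j :: int
  assumes c: "0 < c" "c < 1" and m: "0 < m" and y: "0 \<le> y" "y \<le> int m"
    and near: "\<bar>real_of_int y - c * m\<bar> \<le> 1"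
  shows "binw m c (y + j) \<le> binw m c y * (exp (1 / c + 1 / (1 - c) + 1) * exp (- (real_of_int j)\<^sup>2 / (2 * real m)))"
proof -
  have mono: "binw m c y * (exp (e + 1) * g) \<le> binw m c y * (exp (1 / c + 1 / (1 - c) + 1) * g)"
    if "e \<le> 1 / c + 1 / (1 - c)" "0 \<le> g" for e g :: real
    using that c by (intro mult_left_mono mult_right_mono binw_nonneg) auto
  have inv: "0 \<le> 1 / c" "0 \<le> 1 / (1 - c)" using c by auto
  show ?thesis
  proof (cases "0 \<le> j")
    case True
    then obtain l where l: "j = int l" using nonneg_int_cases by blast
    have "binw m c (y + j) \<le> binw m c y * (exp (1 / (1 - c) + 1) * exp (- (real_of_int j)\<^sup>2 / (2 * real m)))"
      using binw_up_gauss[OF assms, of l] by (simp add: l)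
    also have "\<dots> \<le> binw m c y * (exp (1 / c + 1 / (1 - c) + 1) * exp (- (real_of_int j)\<^sup>2 / (2 * real m)))"
      using inv by (intro mono) auto
    finally show ?thesis .
  next
    case False
    then obtain l where l: "j = - int l" by (cases j rule: int_cases2) auto
    have "binw m (1 - c) (int m - y + int l)
        \<le> binw m (1 - c) (int m - y) * (exp (1 / (1 - (1 - c)) + 1) * exp (- (real l)\<^sup>2 / (2 * real m)))"
      using c m y near by (intro binw_up_gauss) (auto simp: algebra_simps abs_if split: if_splits)
    moreover have "int m - y + int l = int m - (y + j)" by (simp add: l)
    ultimately have "binw m c (y + j) \<le> binw m c y * (exp (1 / c + 1) * exp (- (real_of_int j)\<^sup>2 / (2 * real m)))"
      by (simp only: binw_reflect) (simp add: l)
    also have "\<dots> \<le> binw m c y * (exp (1 / c + 1 / (1 - c) + 1) * exp (- (real_of_int j)\<^sup>2 / (2 * real m)))"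
      using inv by (intro mono) auto
    finally show ?thesis .
  qed
qed

text \<open>The quotient of neighbouring weights is \<open>(1 + x) / (1 + z)\<close> with small
  \<open>x\<close> and \<open>z\<close>. Up to the error of the logarithm a step adds
  \<open>x - z\<close>, which is close to \<open>- (2 * i + 1) / (2 * m * c * (1 - c))\<close>, and
  odd numbers sum to squares. The end point \<open>j\<close> stays fixed in the induction so that
  all steps share one error bound.\<close>

lemma binw_up_approx:
  assumes \<epsilon>: "0 < \<epsilon>" "\<epsilon> \<le> c" "\<epsilon> \<le> 1 - c" and m: "0 < m" and y: "0 \<le> y" "y \<le> int m"
    and near: "\<bar>real_of_int y - c * m\<bar> \<le> 1"
    and j: "real j + 1 \<le> m * \<epsilon> / 2" and i: "i \<le> j"
  shows "\<exists>E. binw m c (y + int i) = binw m c y * exp E \<and>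
      \<bar>E + (real i)\<^sup>2 / (2 * real m * c * (1 - c))\<bar> \<le> real i * (4 * ((real j + 1) / (real m * \<epsilon>))\<^sup>2 + 3 / (real m * \<epsilon>))"
  using i
proof (induction i)
  case 0
  show ?case by (rule exI[of _ 0]) simp
next
  case (Suc i)
  have c: "0 < c" "c < 1" using \<epsilon> by auto
  define \<eta> where "\<eta> = (real j + 1) / (real m * \<epsilon>)"
  define b where "b = 4 * \<eta>\<^sup>2 + 3 / (real m * \<epsilon>)"
  \<comment> \<open>Keeps \<open>x\<close> and \<open>z\<close> within \<open>1 / 2\<close>, where
    the quadratic bound for \<open>ln (1 + x) - x\<close> is available.\<close>
  have \<eta>: "0 \<le> \<eta>" "\<eta> \<le> 1 / 2"
    using j m \<epsilon> by (auto simp: \<eta>_def field_simps)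
  obtain E where E: "binw m c (y + int i) = binw m c y * exp E"
      "\<bar>E + (real i)\<^sup>2 / (2 * real m * c * (1 - c))\<bar> \<le> i * b"
    using Suc unfolding b_def \<eta>_def by auto
  define \<theta> where "\<theta> = c * m - y"
  have \<theta>: "\<bar>\<theta>\<bar> \<le> 1" using near by (simp add: \<theta>_def abs_minus_commute)
  define x z where "x = (\<theta> - i) / (real m * (1 - c))" and "z = (i + 1 - \<theta>) / (real m * c)"
  have ij: "real i + 1 \<le> real j" using Suc.prems by linarith
  have small: "\<bar>a / (real m * d)\<bar> \<le> \<eta>" if "\<bar>a\<bar> \<le> real j + 1" "\<epsilon> \<le> d" for a d
  proof -
    have "\<bar>a / (real m * d)\<bar> = \<bar>a\<bar> / (real m * d)" using that \<epsilon> by (simp add: abs_mult)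
    also have "\<dots> \<le> (real j + 1) / (real m * \<epsilon>)"
      using that \<epsilon> m by (intro frac_le mult_left_mono) auto
    finally show ?thesis by (simp add: \<eta>_def)
  qed
  have x: "\<bar>x\<bar> \<le> \<eta>" and z: "\<bar>z\<bar> \<le> \<eta>"
    unfolding x_def z_def using \<theta> ij \<epsilon> by (intro small; linarith)+
  have lnx: "\<bar>ln (1 + x) - x\<bar> \<le> 2 * \<eta>\<^sup>2" and lnz: "\<bar>ln (1 + z) - z\<bar> \<le> 2 * \<eta>\<^sup>2"
    using abs_ln_one_plus_x_minus_x_bound[of x] abs_ln_one_plus_x_minus_x_bound[of z]
      abs_le_square_iff[of x \<eta>] abs_le_square_iff[of z \<eta>] x z \<eta> by auto
  have small': "\<bar>a / (real m * d)\<bar> \<le> 3 / (real m * \<epsilon>) / 2" if "\<bar>a\<bar> \<le> 3 / 2" "\<epsilon> \<le> d" for a d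
  proof -
    have "\<bar>a / (real m * d)\<bar> = \<bar>a\<bar> / (real m * d)" using that \<epsilon> by (simp add: abs_mult)
    also have "\<dots> \<le> (3 / 2) / (real m * \<epsilon>)"
      using that \<epsilon> m by (intro frac_le mult_left_mono) auto
    finally show ?thesis by simp
  qed
  have halves: "\<bar>a\<bar> \<le> t" if "a = b + d" "\<bar>b\<bar> \<le> t / 2" "\<bar>d\<bar> \<le> t / 2" for a b d t :: real
    using that by linarith
  \<comment> \<open>\<open>1 / (c * (1 - c))\<close> splits into \<open>1 / c + 1 / (1 - c)\<close>.
    Then \<open>i\<close> drops out of both numerators, leaving the offset \<open>\<theta>\<close>
    and a half, at most \<open>3 / 2\<close> in absolute value.\<close>
  have "x - z + (2 * real i + 1) / (2 * real m * c * (1 - c)) = (\<theta> + 1/2) / (real m * (1 - c)) + (\<theta> - 1/2) / (real m * c)"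
  proof -
    have "(2 * real i + 1) / (2 * real m * c * (1 - c))
        = (2 * real i + 1) / 2 / (real m * c) + (2 * real i + 1) / 2 / (real m * (1 - c))"
      using c m by (simp add: divide_simps, simp add: algebra_simps)
    then show ?thesis
      unfolding x_def z_def by (simp add: diff_divide_distrib add_divide_distrib)
  qed
  moreover have "\<bar>(\<theta> + 1/2) / (real m * (1 - c))\<bar> \<le> 3 / (real m * \<epsilon>) / 2" "\<bar>(\<theta> - 1/2) / (real m * c)\<bar> \<le> 3 / (real m * \<epsilon>) / 2"
    using \<theta> \<epsilon> by (intro small'; linarith)+
  ultimately have lin: "\<bar>x - z + (2 * real i + 1) / (2 * real m * c * (1 - c))\<bar> \<le> 3 / (real m * \<epsilon>)" by (rule halves)
  define L where "L = ln (1 + x) - ln (1 + z)"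
  have pos: "0 < 1 + x" "0 < 1 + z" using x z \<eta> by linarith+
  have L: "exp L = (1 + x) / (1 + z)" using pos by (simp add: L_def exp_diff)
  \<comment> \<open>There is room above: \<open>y + i\<close> stays below \<open>m\<close>, so that
    \<open>binw_Suc\<close> applies.\<close>
  have "2 * (real j + 1) \<le> m * \<epsilon>" using j by simp
  also have "m * \<epsilon> \<le> m * (1 - c)" using \<epsilon> by (intro mult_left_mono) auto
  also have "m * (1 - c) = m - y - \<theta>" by (simp add: \<theta>_def algebra_simps)
  finally have "real_of_int (y + int i) < real_of_int (int m)"
    using ij \<theta> by simp
  then have less: "y + int i < int m"
    by (simp only: of_int_less_iff)
  have x1: "1 + x = (real m - y - i) / (real m * (1 - c))"
    using c m by (simp add: x_def \<theta>_def field_simps)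
  have z1: "1 + z = (real_of_int y + i + 1) / (real m * c)"
    using c m by (simp add: z_def \<theta>_def field_simps)
  have Y: "0 < (real_of_int y + i + 1) * (1 - c)" using y c by simp
  have "exp L = (real m - y - i) * c / ((real_of_int y + i + 1) * (1 - c))"
    unfolding L x1 z1 using c m Y by (simp add: divide_simps)
  moreover have "binw m c (y + int (Suc i)) * ((real_of_int y + i + 1) * (1 - c)) = binw m c (y + int i) * ((real m - y - i) * c)"
    using binw_Suc[of "y + int i" m c] y less by (simp add: algebra_simps)
  ultimately have "binw m c (y + int (Suc i)) = binw m c (y + int i) * exp L"
    using Y by (metis less_irrefl nonzero_mult_div_cancel_right times_divide_eq_right)
  then have "binw m c (y + int (Suc i)) = binw m c y * exp (E + L)"
    by (simp add: E exp_add)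
  moreover have "\<bar>E + L + (real (Suc i))\<^sup>2 / (2 * real m * c * (1 - c))\<bar> \<le> Suc i * b"
  proof -
    have "(real (Suc i))\<^sup>2 / (2 * real m * c * (1 - c))
        = (real i)\<^sup>2 / (2 * real m * c * (1 - c)) + (2 * real i + 1) / (2 * real m * c * (1 - c))"
      by (simp add: add_divide_distrib[symmetric] power2_eq_square algebra_simps)
    moreover have "Suc i * b = i * b + (4 * \<eta>\<^sup>2 + 3 / (real m * \<epsilon>))"
      unfolding b_def[symmetric] by (simp add: algebra_simps)
    ultimately show ?thesis using E(2) lnx lnz lin unfolding L_def by linarith
  qed
  ultimately show ?case unfolding b_def \<eta>_def by blast
qed

text \<open>Reflection suffices for negative \<open>j\<close> because the exponent and the
  conditions on \<open>\<epsilon>\<close> are symmetric in \<open>c\<close> and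
  \<open>1 - c\<close>.\<close>

lemma binw_approx:
  fixes j :: int
  assumes \<epsilon>: "0 < \<epsilon>" "\<epsilon> \<le> c" "\<epsilon> \<le> 1 - c" and m: "0 < m" and y: "0 \<le> y" "y \<le> int m"
    and near: "\<bar>real_of_int y - c * m\<bar> \<le> 1" and j: "\<bar>real_of_int j\<bar> + 1 \<le> m * \<epsilon> / 2"
  shows "\<exists>E. binw m c (y + j) = binw m c y * exp E \<and>
      \<bar>E + (real_of_int j)\<^sup>2 / (2 * real m * c * (1 - c))\<bar>
        \<le> \<bar>real_of_int j\<bar> * (4 * ((\<bar>real_of_int j\<bar> + 1) / (real m * \<epsilon>))\<^sup>2 + 3 / (real m * \<epsilon>))"
proof (cases "0 \<le> j")
  case True
  then obtain l where l: "j = int l" using nonneg_int_cases by blast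
  show ?thesis using binw_up_approx[OF \<epsilon> m y near, of l l] j by (simp add: l)
next
  case False
  then obtain l where l: "j = - int l" by (cases j rule: int_cases2) auto
  have "\<exists>E. binw m (1 - c) (int m - y + int l) = binw m (1 - c) (int m - y) * exp E \<and>
      \<bar>E + (real l)\<^sup>2 / (2 * real m * (1 - c) * (1 - (1 - c)))\<bar>
        \<le> real l * (4 * ((real l + 1) / (real m * \<epsilon>))\<^sup>2 + 3 / (real m * \<epsilon>))"
    using \<epsilon> m y near j l
    by (intro binw_up_approx) (auto simp: algebra_simps abs_if split: if_splits)
  moreover have "int m - y + int l = int m - (y + j)" by (simp add: l)
  ultimately show ?thesis
    by (simp only: binw_reflect) (simp add: l mult_ac)
qed

text \<open>For \<open>j\<close> of order \<open>sqrt m\<close> the error in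
  \<open>binw_approx\<close> is \<open>\<bar>j\<bar>\<close> times a term of order
  \<open>1 / m\<close>, hence of order \<open>1 / sqrt m\<close>.\<close>

lemma binw_local_limit:
  fixes m :: "nat \<Rightarrow> nat" and c :: "nat \<Rightarrow> real" and y j :: "nat \<Rightarrow> int"
  assumes m: "filterlim m at_top sequentially" and c: "c \<longlonglongrightarrow> c'" "0 < c'" "c' < 1"
    and y: "\<forall>\<^sub>F n in sequentially. 0 \<le> y n \<and> y n \<le> int (m n) \<and> \<bar>real_of_int (y n) - c n * m n\<bar> \<le> 1"
    and j: "(\<lambda>n. j n / sqrt (m n)) \<longlonglongrightarrow> u"
  shows "(\<lambda>n. binw (m n) (c n) (y n + j n) / binw (m n) (c n) (y n)) \<longlonglongrightarrow> exp (- (u\<^sup>2 / (2 * c' * (1 - c'))))"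
proof -
  define \<epsilon> where "\<epsilon> = min c' (1 - c') / 2"
  have \<epsilon>: "0 < \<epsilon>" "\<epsilon> < c'" "\<epsilon> < 1 - c'" using c by (auto simp: \<epsilon>_def min_def)
  have m': "filterlim (\<lambda>n. real (m n)) at_top sequentially"
    by (rule filterlim_compose[OF filterlim_real_sequentially m])
  have sq: "filterlim (\<lambda>n. sqrt (real (m n))) at_top sequentially"
    by (rule filterlim_compose[OF sqrt_at_top m'])
  have inv: "(\<lambda>n. 1 / sqrt (real (m n))) \<longlonglongrightarrow> 0"
    by (rule tendsto_divide_0[OF tendsto_const filterlim_at_top_imp_at_infinity[OF sq]])
  \<comment> \<open>Scaled displacement and mesh: expressed in these, the error \<open>e n\<close>
    is \<open>q n * r n\<close> times a bounded factor.\<close>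
  define q where "q n = \<bar>j n / sqrt (m n)\<bar>" for n
  define r where "r n = 1 / sqrt (real (m n))" for n
  have q: "q \<longlonglongrightarrow> \<bar>u\<bar>" unfolding q_def by (intro tendsto_rabs j)
  have r: "r \<longlonglongrightarrow> 0" unfolding r_def by (rule inv)
  define e where "e n = \<bar>real_of_int (j n)\<bar> * (4 * ((\<bar>real_of_int (j n)\<bar> + 1) / (real (m n) * \<epsilon>))\<^sup>2 + 3 / (real (m n) * \<epsilon>))" for n
  have ev_m: "\<forall>\<^sub>F n in sequentially. m n > 0"
    using m[unfolded filterlim_at_top, rule_format, of 1] by eventually_elim simp
  have "(\<lambda>n. q n * r n * (4 * ((q n + r n) / \<epsilon>)\<^sup>2 + 3 / \<epsilon>)) \<longlonglongrightarrow> \<bar>u\<bar> * 0 * (4 * ((\<bar>u\<bar> + 0) / \<epsilon>)\<^sup>2 + 3 / \<epsilon>)"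
    using \<epsilon> by (intro tendsto_intros q r) auto
  moreover have "\<forall>\<^sub>F n in sequentially. q n * r n * (4 * ((q n + r n) / \<epsilon>)\<^sup>2 + 3 / \<epsilon>) = e n"
    using ev_m
  proof eventually_elim
    case (elim n)
    define s where "s = sqrt (real (m n))"
    have s: "s > 0" "real (m n) = s * s" using elim by (auto simp: s_def)
    have "q n = \<bar>real_of_int (j n)\<bar> / s" "r n = 1 / s"
      unfolding q_def r_def s_def[symmetric] using s(1) by auto
    moreover note s
    moreover have "x / s * (1 / s) * (4 * ((x / s + 1 / s) / \<epsilon>)\<^sup>2 + 3 / \<epsilon>)
        = x * (4 * ((x + 1) / (s * s * \<epsilon>))\<^sup>2 + 3 / (s * s * \<epsilon>))" for x
      using s(1) \<epsilon> by (simp add: field_simps power2_eq_square)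
    ultimately show ?case unfolding e_def by simp
  qed
  ultimately have e: "e \<longlonglongrightarrow> 0" by (simp add: tendsto_cong)
  have "(\<lambda>n. (q n + r n) * r n) \<longlonglongrightarrow> (\<bar>u\<bar> + 0) * 0"
    by (intro tendsto_intros q r)
  then have "\<forall>\<^sub>F n in sequentially. (q n + r n) * r n < \<epsilon> / 2"
    using \<epsilon> by (intro order_tendstoD(2)[of _ 0]) auto
  then have ev_j: "\<forall>\<^sub>F n in sequentially. \<bar>real_of_int (j n)\<bar> + 1 \<le> m n * \<epsilon> / 2"
    using ev_m
  proof eventually_elim
    case (elim n)
    define s where "s = sqrt (real (m n))"
    have s: "s > 0" "real (m n) = s * s" using elim by (auto simp: s_def)
    have "q n = \<bar>real_of_int (j n)\<bar> / s" "r n = 1 / s"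
      unfolding q_def r_def s_def[symmetric] using s(1) by auto
    moreover note s
    moreover have "(x / s + 1 / s) * (1 / s) = (x + 1) / (s * s)" for x
      using s(1) by (simp add: field_simps)
    ultimately have "(\<bar>real_of_int (j n)\<bar> + 1) / m n < \<epsilon> / 2" using elim by simp
    then show ?case using elim by (simp add: field_simps)
  qed
  have ev_c: "\<forall>\<^sub>F n in sequentially. \<epsilon> < c n" "\<forall>\<^sub>F n in sequentially. c n < 1 - \<epsilon>"
    using \<epsilon> by (auto intro!: order_tendstoD[OF c(1)])
  define E where "E n = ln (binw (m n) (c n) (y n + j n) / binw (m n) (c n) (y n))" for n
  have ev_E: "\<forall>\<^sub>F n in sequentially. exp (E n) = binw (m n) (c n) (y n + j n) / binw (m n) (c n) (y n) \<and>
      \<bar>E n + (real_of_int (j n))\<^sup>2 / (2 * real (m n) * c n * (1 - c n))\<bar> \<le> e n"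
    using ev_m ev_j ev_c y
  proof eventually_elim
    case (elim n)
    then obtain E' where E': "binw (m n) (c n) (y n + j n) = binw (m n) (c n) (y n) * exp E'"
      "\<bar>E' + (real_of_int (j n))\<^sup>2 / (2 * real (m n) * c n * (1 - c n))\<bar> \<le> e n"
      using binw_approx[of \<epsilon> "c n" "m n" "y n" "j n"] \<epsilon> unfolding e_def by auto
    moreover have "binw (m n) (c n) (y n) > 0" using elim \<epsilon> by (intro binw_pos) auto
    ultimately have "E n = E'" by (simp add: E_def)
    with E' \<open>binw (m n) (c n) (y n) > 0\<close> show ?case by simp
  qed
  define g where "g n = (j n / sqrt (m n))\<^sup>2 / (2 * c n * (1 - c n))" for n
  have g: "g \<longlonglongrightarrow> u\<^sup>2 / (2 * c' * (1 - c'))"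
    unfolding g_def using c by (intro tendsto_intros j) auto
  have "(\<lambda>n. E n + g n) \<longlonglongrightarrow> 0"
  proof (rule tendsto_rabs_zero_cancel, rule tendsto_sandwich[OF _ _ tendsto_const e])
    show "\<forall>\<^sub>F n in sequentially. \<bar>E n + g n\<bar> \<le> e n"
      using ev_E by eventually_elim (simp add: g_def power_divide mult_ac)
  qed simp
  then have "(\<lambda>n. (E n + g n) - g n) \<longlonglongrightarrow> 0 - u\<^sup>2 / (2 * c' * (1 - c'))"
    by (intro tendsto_diff g)
  then have "(\<lambda>n. exp (E n)) \<longlonglongrightarrow> exp (- (u\<^sup>2 / (2 * c' * (1 - c'))))"
    by (intro tendsto_exp) simp
  moreover have "\<forall>\<^sub>F n in sequentially. exp (E n) = binw (m n) (c n) (y n + j n) / binw (m n) (c n) (y n)"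
    using ev_E by eventually_elim simp
  ultimately show ?thesis by (simp add: tendsto_cong)
qed

section \<open>Tilting and conditional expectations\<close>

text \<open>\<open>A\<close> is the odds of \<open>p i\<close> over the odds of \<open>c i\<close>,
  which the defining equations make independent of \<open>i\<close>.\<close>

lemma is_block_probs_odds:
  assumes p: "\<And>i. 0 < p i" "\<And>i. p i < 1" and c: "is_block_probs p m k c"
  obtains A where "0 < A" "\<And>i. c i = p i / (p i + A * (1 - p i))"
    "\<And>i. (1 - c i) * p i = A * (c i * (1 - p i))"
proof -
  define A where "A = (1 - c undefined) / c undefined * (p undefined / (1 - p undefined))"
  have c01: "0 < c i" "c i < 1" for i using c by (auto simp: is_block_probs_def)
  have "(1 - c i) / c i * (p i / (1 - p i)) = A" for i
    using c unfolding is_block_probs_def A_def by blast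
  then have A: "(1 - c i) * p i = A * (c i * (1 - p i))" for i
    using c01[of i] p[of i] by (simp add: divide_eq_eq)
  have A0: "A > 0"
    unfolding A_def using c01[of undefined] p[of undefined] by simp
  have "c i = p i / (p i + A * (1 - p i))" for i
  proof -
    have "p i + A * (1 - p i) > 0" using p[of i] A0 by (simp add: add_pos_pos)
    moreover have "c i * (p i + A * (1 - p i)) = p i" using A[of i] by (simp add: algebra_simps)
    ultimately show ?thesis by (simp add: eq_divide_eq)
  qed
  with A A0 show thesis by (rule that[rotated 2])
qed

text \<open>The sum is decreasing in the tilt, so it is enough to compare \<open>A n\<close> with a
  fixed \<open>B\<close> on either side of the limit. There the sum converges to a value different
  from \<open>a\<close>, and pointwise convergence in \<open>B\<close> suffices.\<close>

lemma tilt_tendsto: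
  fixes p \<alpha> :: "'m::finite \<Rightarrow> real"
  assumes p: "\<And>i. 0 < p i" "\<And>i. p i < 1" and \<alpha>: "\<And>i. 0 < \<alpha> i"
    and a: "0 < a" "a < (\<Sum>i\<in>UNIV. \<alpha> i)"
    and w: "\<And>i. (\<lambda>n. w n i) \<longlonglongrightarrow> \<alpha> i" "\<And>n i. 0 \<le> w n i"
    and A: "\<forall>\<^sub>F n in sequentially. 0 < A n"
    and lim: "(\<lambda>n. \<Sum>i\<in>UNIV. p i * w n i / (p i + A n * (1 - p i))) \<longlonglongrightarrow> a"
  shows "0 < tilt p \<alpha> a" "A \<longlonglongrightarrow> tilt p \<alpha> a"
proof -
  define F where "F w B = (\<Sum>i\<in>UNIV. p i * w i / (p i + B * (1 - p i)))" for w B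
  define T where "T = tilt p \<alpha> a"
  have T: "0 < T" "F \<alpha> T = a"
    using theI'[OF tilt_ex1[of p \<alpha> a, OF p \<alpha> a]] by (auto simp: F_def T_def tilt_def)
  then show "0 < tilt p \<alpha> a" by (simp add: T_def)
  have den: "p i + B * (1 - p i) > 0" if "B \<ge> 0" for B i
    using p[of i] that by (simp add: add_pos_nonneg)
  have den_mono: "p i + B * (1 - p i) \<le> p i + B' * (1 - p i)" if "B \<le> B'" for B B' i
    using that p[of i] by simp
  have mono: "F w' B' \<le> F w' B" if "0 \<le> B" "B \<le> B'" "\<And>i. 0 \<le> w' i" for B B' w'
    unfolding F_def using that den[of B] den[of B'] den_mono[of B B'] p[THEN less_imp_le]
    by (intro sum_mono divide_left_mono mult_pos_pos mult_nonneg_nonneg) auto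
  have strict: "F \<alpha> B' < F \<alpha> B" if "0 \<le> B" "B < B'" for B B'
    unfolding F_def
  proof (rule sum_strict_mono)
    fix i :: 'm
    have "p i + B * (1 - p i) < p i + B' * (1 - p i)"
      using that p[of i] by simp
    then show "p i * \<alpha> i / (p i + B' * (1 - p i)) < p i * \<alpha> i / (p i + B * (1 - p i))"
      using that p[of i] \<alpha>[of i] den[of B i] den[of B' i]
      by (intro divide_strict_left_mono mult_pos_pos) auto
  qed auto
  have F_lim: "(\<lambda>n. F (w n) B) \<longlonglongrightarrow> F \<alpha> B" if "0 \<le> B" for B
    unfolding F_def using den[OF that] by (intro tendsto_intros w) (simp add: less_imp_neq[symmetric])
  have lim': "(\<lambda>n. F (w n) (A n)) \<longlonglongrightarrow> a" using lim by (simp add: F_def)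
  show "A \<longlonglongrightarrow> tilt p \<alpha> a"
    unfolding T_def[symmetric]
  proof (rule order_tendstoI)
    fix B assume B: "T < B"
    then obtain e where e: "F \<alpha> B < e" "e < a" using strict[of T B] T dense by (metis less_imp_le)
    have "\<forall>\<^sub>F n in sequentially. F (w n) B < e"
      using F_lim[of B] B T e by (intro order_tendstoD) auto
    moreover have "\<forall>\<^sub>F n in sequentially. e < F (w n) (A n)"
      using lim' e by (intro order_tendstoD) auto
    ultimately show "\<forall>\<^sub>F n in sequentially. A n < B"
    proof eventually_elim
      case (elim n)
      then show ?case using mono[of B "A n" "w n"] w(2) B T by force
    qed
  next
    fix B assume B: "B < T"
    show "\<forall>\<^sub>F n in sequentially. B < A n"
    proof (cases "0 \<le> B")
      case True
      then obtain e where e: "a < e" "e < F \<alpha> B" using strict[of B T] T B dense by metis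
      have "\<forall>\<^sub>F n in sequentially. e < F (w n) B"
        using F_lim[of B] True e by (intro order_tendstoD) auto
      moreover have "\<forall>\<^sub>F n in sequentially. F (w n) (A n) < e"
        using lim' e by (intro order_tendstoD) auto
      ultimately show ?thesis using A
      proof eventually_elim
        case (elim n)
        then show ?case using mono[of "A n" B "w n"] w(2) by force
      qed
    next
      case False
      then show ?thesis using A by (auto elim: eventually_mono)
    qed
  qed
qed

text \<open>The formula for \<open>c\<close> gives
  \<open>c i - p i = c i * (1 - p i) * (1 - A)\<close>, which is at most \<open>1 - A\<close> once
  \<open>A < 1\<close>.\<close>

lemma odds_excess_le:
  fixes p c :: "'m::finite \<Rightarrow> real"
  assumes p: "\<And>i. 0 < p i" "\<And>i. p i < 1" and A: "0 < A"
    and c: "\<And>i. c i = p i / (p i + A * (1 - p i))"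
    and m: "\<And>i. 0 \<le> m i" and pos: "(\<Sum>i\<in>UNIV. p i * m i) < (\<Sum>i\<in>UNIV. c i * m i)"
  shows "A < 1" "(\<Sum>i\<in>UNIV. c i * m i) - (\<Sum>i\<in>UNIV. p i * m i) \<le> (1 - A) * (\<Sum>i\<in>UNIV. m i)"
proof -
  have den: "p i + A * (1 - p i) > 0" for i
    using p[of i] A by (simp add: add_pos_pos)
  show "A < 1"
  proof (rule ccontr)
    assume "\<not> A < 1"
    have "c i \<le> p i" for i
    proof -
      have "1 * (1 - p i) \<le> A * (1 - p i)" using \<open>\<not> A < 1\<close> p[of i] by (intro mult_right_mono) auto
      then have "1 \<le> p i + A * (1 - p i)" by (simp add: algebra_simps)
      then have "p i * 1 \<le> p i * (p i + A * (1 - p i))" using p[of i] by (intro mult_left_mono) auto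
      then show ?thesis using den[of i] by (simp add: c divide_le_eq)
    qed
    then have "(\<Sum>i\<in>UNIV. c i * m i) \<le> (\<Sum>i\<in>UNIV. p i * m i)"
      using m by (intro sum_mono mult_right_mono)
    with pos show False by simp
  qed
  have "c i - p i \<le> 1 - A" for i
  proof -
    have "c i - p i = (p i / (p i + A * (1 - p i))) * ((1 - p i) * (1 - A))"
      using den[of i] by (simp add: c field_simps)
    also have "\<dots> \<le> 1 * (1 * (1 - A))"
      using p[of i] A den[of i] \<open>A < 1\<close> by (intro mult_mono) auto
    finally show ?thesis by simp
  qed
  then have "(\<Sum>i\<in>UNIV. (c i - p i) * m i) \<le> (\<Sum>i\<in>UNIV. (1 - A) * m i)"
    using m by (intro sum_mono mult_right_mono)
  then show "(\<Sum>i\<in>UNIV. c i * m i) - (\<Sum>i\<in>UNIV. p i * m i) \<le> (1 - A) * (\<Sum>i\<in>UNIV. m i)"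
    by (simp add: left_diff_distrib sum_subtractf sum_distrib_left)
qed

section \<open>Expectations of functions of independent binomial variables\<close>

context prob_space
begin

text \<open>A finite index type leaves only countably many vectors of naturals, so measurability can
  be checked on single points.\<close>

lemma random_variable_nat_vector:
  fixes X :: "'m::finite \<Rightarrow> 'a \<Rightarrow> nat"
  assumes X: "\<And>i. random_variable (count_space UNIV) (X i)"
  shows "random_variable (count_space UNIV) (\<lambda>\<omega> i. X i \<omega>)"
proof (subst measurable_count_space_eq2_countable, safe)
  fix y :: "'m \<Rightarrow> nat"
  have "(\<lambda>\<omega> i. X i \<omega>) -` {y} \<inter> space M = (\<Inter>i\<in>UNIV. X i -` {y i} \<inter> space M)"
    by (auto simp: fun_eq_iff)
  also have "\<dots> \<in> events"
    using X by (intro sets.finite_INT measurable_sets) auto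
  finally show "(\<lambda>\<omega> i. X i \<omega>) -` {y} \<inter> space M \<in> events" .
qed auto

text \<open>Almost surely the vector lies in a finite box, so \<open>F\<close> of it is a finite
  combination of indicators and integrable for arbitrary \<open>F\<close>.\<close>

lemma expectation_binomial_vector:
  fixes X :: "'m::finite \<Rightarrow> 'a \<Rightarrow> nat" and F :: "('m \<Rightarrow> nat) \<Rightarrow> real"
  assumes indep: "indep_vars (\<lambda>_. count_space UNIV) X UNIV"
    and distr: "\<And>i. distr M (count_space UNIV) (X i) = measure_pmf (binomial_pmf (m i) (p i))"
    and p: "\<And>i. 0 < p i" "\<And>i. p i < 1"
  shows "expectation (\<lambda>\<omega>. F (\<lambda>i. X i \<omega>))
      = (\<Sum>y\<in>PiE UNIV (\<lambda>i. {..m i}). F y * (\<Prod>i\<in>UNIV. pmf (binomial_pmf (m i) (p i)) (y i)))"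
proof -
  let ?N = "PiE UNIV (\<lambda>i. {..m i})"
  have X [measurable]: "random_variable (count_space UNIV) (X i)" for i
    using indep by (auto simp: indep_vars_def)
  have fin: "finite ?N" by (intro finite_PiE) auto
  have sets: "(\<lambda>\<omega> i. X i \<omega>) -` {y} \<inter> space M \<in> events" for y
    using random_variable_nat_vector[of X, OF X] by (rule measurable_sets) auto
  have prob: "prob ((\<lambda>\<omega> i. X i \<omega>) -` {y} \<inter> space M) = (\<Prod>i\<in>UNIV. pmf (binomial_pmf (m i) (p i)) (y i))" for y
  proof -
    have "(\<lambda>\<omega> i. X i \<omega>) -` {y} \<inter> space M = (\<Inter>i\<in>UNIV. X i -` {y i} \<inter> space M)"
      by (auto simp: fun_eq_iff)
    also have "prob \<dots> = (\<Prod>i\<in>UNIV. prob (X i -` {y i} \<inter> space M))"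
      by (rule indep_varsD_finite[OF indep]) auto
    also have "\<dots> = (\<Prod>i\<in>UNIV. pmf (binomial_pmf (m i) (p i)) (y i))"
    proof (rule prod.cong[OF refl])
      fix i
      have "prob (X i -` {y i} \<inter> space M) = measure (distr M (count_space UNIV) (X i)) {y i}"
        by (subst measure_distr) auto
      then show "prob (X i -` {y i} \<inter> space M) = pmf (binomial_pmf (m i) (p i)) (y i)"
        by (simp add: distr measure_pmf_single)
    qed
    finally show ?thesis .
  qed
  have "AE \<omega> in M. X i \<omega> \<le> m i" for i
  proof -
    have "AE x in distr M (count_space UNIV) (X i). x \<le> m i"
      unfolding distr using p[of i] by (auto simp: AE_measure_pmf_iff)
    then show ?thesis by (subst (asm) AE_distr_iff) auto
  qed
  then have "AE \<omega> in M. \<forall>i. X i \<omega> \<le> m i"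
    by (simp add: AE_all_countable)
  then have "AE \<omega> in M. F (\<lambda>i. X i \<omega>) = (\<Sum>y\<in>?N. F y * indicator ((\<lambda>\<omega> i. X i \<omega>) -` {y} \<inter> space M) \<omega>)"
    using AE_space
  proof eventually_elim
    case (elim \<omega>)
    have "(\<Sum>y\<in>?N. F y * indicator ((\<lambda>\<omega> i. X i \<omega>) -` {y} \<inter> space M) \<omega>)
        = (\<Sum>y\<in>?N. if y = (\<lambda>i. X i \<omega>) then F y else 0)"
      using elim by (intro sum.cong) (auto simp: indicator_def)
    also have "\<dots> = F (\<lambda>i. X i \<omega>)"
      using elim fin by (simp add: PiE_UNIV_domain)
    finally show ?case by simp
  qed
  then have "expectation (\<lambda>\<omega>. F (\<lambda>i. X i \<omega>))
      = expectation (\<lambda>\<omega>. \<Sum>y\<in>?N. F y * indicator ((\<lambda>\<omega> i. X i \<omega>) -` {y} \<inter> space M) \<omega>)"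
  proof (rule integral_cong_AE[rotated 2])
    show "(\<lambda>\<omega>. F (\<lambda>i. X i \<omega>)) \<in> borel_measurable M"
      using random_variable_nat_vector[of X, OF X] by (rule measurable_compose) auto
    show "(\<lambda>\<omega>. \<Sum>y\<in>?N. F y * indicator ((\<lambda>\<omega> i. X i \<omega>) -` {y} \<inter> space M) \<omega>) \<in> borel_measurable M"
      using sets by (intro borel_measurable_sum borel_measurable_times borel_measurable_indicator) auto
  qed
  also have "\<dots> = (\<Sum>y\<in>?N. F y * prob ((\<lambda>\<omega> i. X i \<omega>) -` {y} \<inter> space M))"
    using sets by (subst Bochner_Integration.integral_sum) (auto intro!: integrable_mult_right integrable_real_indicator simp: less_top[symmetric])
  finally show ?thesis by (simp add: prob)
qed

lemma integral_uniform_measure: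
  fixes f :: "'a \<Rightarrow> real"
  assumes [measurable]: "A \<in> events" "f \<in> borel_measurable M" and "prob A \<noteq> 0"
  shows "(\<integral>x. f x \<partial>uniform_measure M A) = expectation (\<lambda>x. indicator A x * f x) / prob A"
proof -
  have "0 < prob A" using assms(3) by (simp add: zero_less_measure_iff)
  then have "uniform_measure M A = density M (\<lambda>x. ennreal (indicator A x / prob A))"
    unfolding uniform_measure_def
    by (intro density_cong)
       (auto simp: indicator_def emeasure_eq_measure divide_ennreal ennreal_1[symmetric] simp del: ennreal_1)
  then have "(\<integral>x. f x \<partial>uniform_measure M A) = expectation (\<lambda>x. (indicator A x / prob A) *\<^sub>R f x)"
    by (simp add: integral_density)
  then show ?thesis by simp
qed

end

text \<open>With \<open>q = (1 - p) / (1 - c)\<close> one has \<open>p = A * c * q\<close> and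
  \<open>1 - p = q * (1 - c)\<close>: every trial contributes a factor \<open>q\<close>, and every
  success a further factor \<open>A\<close>.\<close>

lemma pmf_binomial_tilt:
  assumes p: "0 < p" "p < 1" and c: "0 < c" "c < 1"
    and odds: "(1 - c) * p = A * (c * (1 - p))" and y: "y \<le> m"
  shows "pmf (binomial_pmf m p) y = ((1 - p) / (1 - c)) ^ m * (A ^ y * (real (m choose y) * c ^ y * (1 - c) ^ (m - y)))"
proof -
  define q where "q = (1 - p) / (1 - c)"
  have q: "1 - p = q * (1 - c)" using c by (simp add: q_def)
  have p': "p = A * c * q" using odds c by (simp add: q mult_ac)
  have "q ^ m = q ^ y * q ^ (m - y)" using y by (simp add: power_add[symmetric])
  moreover have "(1 - p) ^ (m - y) = q ^ (m - y) * (1 - c) ^ (m - y)"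
    unfolding q by (rule power_mult_distrib)
  moreover have "p ^ y = A ^ y * c ^ y * q ^ y"
    by (simp only: p' power_mult_distrib)
  moreover have "pmf (binomial_pmf m p) y = real (m choose y) * p ^ y * (1 - p) ^ (m - y)"
    using p by simp
  ultimately show ?thesis
    unfolding q_def[symmetric] by (simp add: mult_ac)
qed

lemma scale_measure_eq_density: "scale_measure r M = density M (\<lambda>_. r)"
  by (rule measure_eqI) (auto simp: emeasure_density nn_integral_cmult_indicator)

context prob_space
begin

lemma expectation_sum_binomial:
  fixes X :: "'m::finite \<Rightarrow> 'a \<Rightarrow> nat"
  assumes X: "\<And>i. random_variable (count_space UNIV) (X i)"
    and distr: "\<And>i. distr M (count_space UNIV) (X i) = measure_pmf (binomial_pmf (m i) (p i))"
    and p: "\<And>i. 0 < p i" "\<And>i. p i < 1"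
  shows "expectation (\<lambda>\<omega>. real (\<Sum>i\<in>UNIV. X i \<omega>)) = (\<Sum>i\<in>UNIV. p i * m i)"
proof -
  have p01: "p i \<in> {0..1}" for i using p[of i] by simp
  have "integrable (distr M (count_space UNIV) (X i)) real" for i
    unfolding distr using p01 by simp
  then have int: "integrable M (\<lambda>\<omega>. real (X i \<omega>))" for i
    using X by (subst (asm) integrable_distr_eq) auto
  have "expectation (\<lambda>\<omega>. real (X i \<omega>)) = p i * m i" for i
  proof -
    have "expectation (\<lambda>\<omega>. real (X i \<omega>)) = measure_pmf.expectation (binomial_pmf (m i) (p i)) real"
      unfolding distr[symmetric] using X by (subst integral_distr) auto
    \<comment> \<open>The mean of the binomial law is the first-moment identity for Bernstein
      polynomials.\<close>
    also have "\<dots> = (\<Sum>y\<le>m i. real y * Bernstein (m i) y (p i))"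
      by (simp add: expectation_binomial_pmf'[OF p01] Bernstein_def mult_ac)
    also have "\<dots> = p i * m i" by (simp add: sum_k_Bernstein)
    finally show ?thesis .
  qed
  then show ?thesis using int by simp
qed

end

section \<open>The limit of the tilted sums\<close>

lemma integrable_exp_square:
  assumes "0 < (a::real)"
  shows "integrable lborel (\<lambda>t::real. exp (- (a * t\<^sup>2)))"
proof -
  define s where "s = sqrt (1 / (2 * a))"
  have s: "s > 0" "s\<^sup>2 = 1 / (2 * a)" using assms by (simp_all add: s_def)
  have "integrable lborel (\<lambda>t. sqrt (2 * pi * s\<^sup>2) * normal_density 0 s t)"
    using s by (intro integrable_mult_right integrable_normal_density) auto
  moreover have "sqrt (2 * pi * s\<^sup>2) * normal_density 0 s t = exp (- (a * t\<^sup>2))" for t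
    using s assms by (simp add: normal_density_def)
  ultimately show ?thesis by simp
qed

lemma has_bochner_integral_exp_Ici: "has_bochner_integral lborel (\<lambda>t::real. indicator {0..} t * exp (- t)) 1"
proof (rule has_bochner_integral_nn_integral)
  show "(\<integral>\<^sup>+ x. ennreal (indicator {0..} x * exp (- x)) \<partial>lborel) = ennreal 1"
    using nn_intergal_power_times_exp_Ici[of 0]
    by (simp add: ennreal_mult'' ennreal_indicator[symmetric] mult.commute del: ennreal_indicator)
qed auto

lemma has_bochner_integral_indicator_Ico:
  "(a::real) \<le> b \<Longrightarrow> has_bochner_integral lborel (indicator {a..<b}) (b - a)"
  using has_bochner_integral_real_indicator[of "{a..<b}" lborel] by simp

lemma has_bochner_integral_exp_Ico:
  assumes "(a::real) \<le> b"
  shows "has_bochner_integral lborel (\<lambda>t. indicator {a..<b} t * exp (- t)) (exp (- a) - exp (- b))"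
proof -
  have "has_bochner_integral lborel (\<lambda>t. exp (- t) * indicator {a..b} t) (- exp (- b) - - exp (- a))"
    using assms
    by (intro has_bochner_integral_FTC_Icc_real) (auto intro!: derivative_eq_intros continuous_intros)
  moreover have "AE t in lborel. exp (- t) * indicator {a..b} t = indicator {a..<b} t * exp (- t)"
    using AE_lborel_singleton[of b] by eventually_elim (auto simp: indicator_def)
  ultimately show ?thesis
    by (subst (asm) has_bochner_integral_cong_AE) auto
qed

lemma tendsto_floor_div:
  assumes s: "filterlim s at_top sequentially"
  shows "(\<lambda>n. real_of_int \<lfloor>s n * t\<rfloor> / s n) \<longlonglongrightarrow> t"
proof -
  have inv: "(\<lambda>n. 1 / s n) \<longlonglongrightarrow> 0"
    by (rule tendsto_divide_0[OF tendsto_const filterlim_at_top_imp_at_infinity[OF s]])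
  have "\<forall>\<^sub>F n in sequentially. 0 < s n"
    using s by (simp add: filterlim_at_top_dense)
  then have "\<forall>\<^sub>F n in sequentially. \<bar>real_of_int \<lfloor>s n * t\<rfloor> / s n - t\<bar> \<le> 1 / s n"
  proof eventually_elim
    case (elim n)
    have "real_of_int \<lfloor>s n * t\<rfloor> / s n - t = (real_of_int \<lfloor>s n * t\<rfloor> - s n * t) / s n"
      using elim by (simp add: field_simps)
    moreover have "\<bar>real_of_int \<lfloor>s n * t\<rfloor> - s n * t\<bar> \<le> 1" by linarith
    ultimately show ?case using elim by (simp add: divide_right_mono)
  qed
  then have "(\<lambda>n. real_of_int \<lfloor>s n * t\<rfloor> / s n - t) \<longlonglongrightarrow> 0"
    by (intro tendsto_rabs_zero_cancel[OF tendsto_sandwich[OF _ _ tendsto_const inv]]) auto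
  then show ?thesis by (simp add: LIM_zero_iff)
qed

text \<open>Applied with \<open>l n = - ln (A n)\<close>: the rounded overshoot is small against
  \<open>sqrt n\<close> because \<open>sqrt n * l n\<close> diverges, whether or not
  \<open>l n\<close> tends to 0.\<close>

lemma tendsto_floor_div_0:
  fixes s l :: "nat \<Rightarrow> real"
  assumes s: "filterlim s at_top sequentially"
    and l: "filterlim (\<lambda>n. s n * l n) at_top sequentially"
  shows "(\<lambda>n. real_of_int \<lfloor>t / l n\<rfloor> / s n) \<longlonglongrightarrow> 0"
proof -
  have "(\<lambda>n. 1 / s n) \<longlonglongrightarrow> 0" "(\<lambda>n. \<bar>t\<bar> / (s n * l n)) \<longlonglongrightarrow> 0"
    using s l by (intro tendsto_divide_0[OF tendsto_const filterlim_at_top_imp_at_infinity]; simp)+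
  from tendsto_add[OF this(2,1)] have lim: "(\<lambda>n. \<bar>t\<bar> / (s n * l n) + 1 / s n) \<longlonglongrightarrow> 0" by simp
  have "\<forall>\<^sub>F n in sequentially. 0 < s n" "\<forall>\<^sub>F n in sequentially. 0 < s n * l n"
    using s l by (simp_all add: filterlim_at_top_dense)
  then have "\<forall>\<^sub>F n in sequentially. \<bar>real_of_int \<lfloor>t / l n\<rfloor> / s n\<bar> \<le> \<bar>t\<bar> / (s n * l n) + 1 / s n"
  proof eventually_elim
    case (elim n)
    have "\<bar>real_of_int \<lfloor>t / l n\<rfloor>\<bar> \<le> \<bar>t / l n\<bar> + 1" by linarith
    moreover have "0 < l n" using elim by (simp add: zero_less_mult_iff)
    ultimately have "\<bar>real_of_int \<lfloor>t / l n\<rfloor>\<bar> / s n \<le> (\<bar>t\<bar> / l n + 1) / s n"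
      using elim by (intro divide_right_mono) auto
    then show ?case using elim by (simp add: add_divide_distrib mult.commute)
  qed
  then show ?thesis
    by (intro tendsto_rabs_zero_cancel[OF tendsto_sandwich[OF _ _ tendsto_const lim]]) auto
qed

section \<open>A chart of \<open>S0\<close> with a spare coordinate for the overshoot\<close>

definition zero_sum_vec :: "'m::finite \<Rightarrow> ('m \<Rightarrow> real) \<Rightarrow> real ^ 'm" where
  "zero_sum_vec i0 u = (\<Sum>i\<in>- {i0}. u i *\<^sub>R (axis i 1 - axis i0 1))"

lemma zero_sum_vec_nth:
  "zero_sum_vec i0 u $ i = (if i = i0 then - (\<Sum>j\<in>- {i0}. u j) else u i)"
proof (cases "i = i0")
  case True
  have "(\<Sum>j\<in>- {i0}. u j * (axis j 1 $ i0 - axis i0 1 $ i0)) = (\<Sum>j\<in>- {i0}. - u j)"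
    by (intro sum.cong) (auto simp: axis_def)
  with True show ?thesis by (simp add: zero_sum_vec_def sum_negf)
next
  case False
  have "(\<Sum>j\<in>- {i0}. u j * (axis j 1 $ i - axis i0 1 $ i)) = (\<Sum>j\<in>- {i0}. if j = i then u j else 0)"
    using False by (intro sum.cong) (auto simp: axis_def)
  with False show ?thesis by (simp add: zero_sum_vec_def)
qed

text \<open>The coordinate \<open>i0\<close> is ignored by the chart and thus free to carry the
  exponential variable.\<close>

lemma zero_sum_vec_upd: "zero_sum_vec i0 (u(i0 := t)) = zero_sum_vec i0 u"
  by (simp add: vec_eq_iff zero_sum_vec_nth)

lemma zero_sum_vec_measurable:
  assumes "- {i0} \<subseteq> I"
  shows "zero_sum_vec i0 \<in> borel_measurable (\<Pi>\<^sub>M i\<in>I. (lborel :: real measure))"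
  unfolding zero_sum_vec_def[abs_def] using assms
  by (intro borel_measurable_sum borel_measurable_scaleR) (auto intro: measurable_component_singleton)

lemma param_lborel_zero_sum_vec:
  "param_lborel (- {i0}) (\<lambda>i. axis i 1 - axis i0 1)
    = distr (\<Pi>\<^sub>M i\<in>- {i0}. (lborel :: real measure)) borel (zero_sum_vec i0)"
  by (simp add: param_lborel_def zero_sum_vec_def[abs_def])

lemma integral_exponential_coordinate:
  fixes h :: "real ^ 'm::finite \<Rightarrow> real" and i0 :: 'm
  assumes int: "integrable (\<Pi>\<^sub>M i\<in>UNIV. (lborel :: real measure))
      (\<lambda>u. indicator {0..} (u i0) * exp (- u i0) * h (zero_sum_vec i0 u))"
    and [measurable]: "h \<in> borel_measurable borel"
  shows "(\<integral>u. indicator {0..} (u i0) * exp (- u i0) * h (zero_sum_vec i0 u) \<partial>(\<Pi>\<^sub>M i\<in>UNIV. (lborel :: real measure)))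
    = (\<integral>z. h z \<partial>param_lborel (- {i0}) (\<lambda>i. axis i 1 - axis i0 1))"
proof -
  have UNIV: "UNIV = insert i0 (- {i0})" by auto
  have "(\<integral>u. indicator {0..} (u i0) * exp (- u i0) * h (zero_sum_vec i0 u) \<partial>(\<Pi>\<^sub>M i\<in>UNIV. (lborel :: real measure)))
      = (\<integral>u. (\<integral>t. indicator {0..} t * exp (- t) * h (zero_sum_vec i0 u) \<partial>lborel) \<partial>(\<Pi>\<^sub>M i\<in>- {i0}. (lborel :: real measure)))"
    using product_lborel.product_integral_insert[OF _ _ int[unfolded UNIV]]
    by (simp add: zero_sum_vec_upd UNIV[symmetric])
  also have "\<dots> = (\<integral>u. h (zero_sum_vec i0 u) \<partial>(\<Pi>\<^sub>M i\<in>- {i0}. (lborel :: real measure)))"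
    using has_bochner_integral_exp_Ici by (simp add: has_bochner_integral_iff)
  also have "\<dots> = (\<integral>z. h z \<partial>param_lborel (- {i0}) (\<lambda>i. axis i 1 - axis i0 1))"
    unfolding param_lborel_zero_sum_vec
    by (subst integral_distr) (auto intro: zero_sum_vec_measurable)
  finally show ?thesis .
qed

text \<open>Separates the analysis from the random variables: the success probabilities enter only
  through \<open>c\<close> and \<open>A\<close>. Some hypotheses are eventual because block
  probabilities are guaranteed only for large n.\<close>

locale tilted_blocks =
  fixes \<alpha> c' :: "'m::finite \<Rightarrow> real" and m :: "nat \<Rightarrow> 'm \<Rightarrow> nat" and k :: "nat \<Rightarrow> nat"
    and c :: "nat \<Rightarrow> 'm \<Rightarrow> real" and A :: "nat \<Rightarrow> real" and i0 :: 'm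
  assumes \<alpha>: "\<And>i. 0 < \<alpha> i" and c': "\<And>i. 0 < c' i" "\<And>i. c' i < 1"
    and m: "\<And>i. (\<lambda>n. real (m n i) / real n) \<longlonglongrightarrow> \<alpha> i"
    and c: "\<And>i. (\<lambda>n. c n i) \<longlonglongrightarrow> c' i"
    and m_le: "\<forall>\<^sub>F n in sequentially. \<forall>i. m n i \<le> n"
    and k: "\<forall>\<^sub>F n in sequentially. (\<Sum>i\<in>UNIV. c n i * m n i) = k n"
    and A01: "\<forall>\<^sub>F n in sequentially. 0 < A n \<and> A n < 1"
    and A: "filterlim (\<lambda>n. sqrt n * (1 - A n)) at_top sequentially"
begin

text \<open>A lattice point within 1 of the mean in each coordinate, as the estimates for
  \<open>binw\<close> ask of their reference point.\<close>

definition base :: "nat \<Rightarrow> 'm \<Rightarrow> int" where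
  "base n i = \<lfloor>c n i * m n i\<rfloor>"

text \<open>The coordinate \<open>i0\<close> is chosen to make the overshoot of \<open>base n + jump n u\<close> over \<open>k n\<close> equal to
  \<open>u i0 / - ln (A n)\<close> rounded down, which is geometric when \<open>u i0\<close> is exponential.\<close>

definition jump :: "nat \<Rightarrow> ('m \<Rightarrow> real) \<Rightarrow> 'm \<Rightarrow> int" where
  "jump n u i = (if i = i0
    then int (k n) - (\<Sum>j\<in>UNIV. base n j) + \<lfloor>u i0 / - ln (A n)\<rfloor> - (\<Sum>j\<in>- {i0}. \<lfloor>sqrt n * u j\<rfloor>)
    else \<lfloor>sqrt n * u i\<rfloor>)"

definition site :: "nat \<Rightarrow> ('m \<Rightarrow> real) \<Rightarrow> 'm \<Rightarrow> int" where
  "site n u i = base n i + jump n u i"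

definition ratio :: "nat \<Rightarrow> ('m \<Rightarrow> int) \<Rightarrow> real" where
  "ratio n y = (\<Prod>i\<in>UNIV. binw (m n i) (c n i) (y i) / binw (m n i) (c n i) (base n i))"

definition centred :: "nat \<Rightarrow> ('m \<Rightarrow> real) \<Rightarrow> real ^ 'm" where
  "centred n y = (\<chi> i. (y i - c n i * m n i) / sqrt n)"

lemma sqrt_lim: "filterlim (\<lambda>n. sqrt (real n)) at_top sequentially"
  by (rule filterlim_compose[OF sqrt_at_top filterlim_real_sequentially])

lemma inv_sqrt_lim: "(\<lambda>n. K / sqrt (real n)) \<longlonglongrightarrow> 0"
  by (rule tendsto_divide_0[OF tendsto_const filterlim_at_top_imp_at_infinity[OF sqrt_lim]])

text \<open>Rounding an exponential variable to a geometric one produces the rate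
  \<open>- ln (A n)\<close>; the inequality \<open>ln x \<le> x - 1\<close> transfers the growth
  condition to it.\<close>

lemma ln_lim: "filterlim (\<lambda>n. sqrt n * - ln (A n)) at_top sequentially"
proof (rule filterlim_at_top_mono[OF A])
  show "\<forall>\<^sub>F n in sequentially. sqrt n * (1 - A n) \<le> sqrt n * - ln (A n)"
    using A01
  proof eventually_elim
    case (elim n)
    then show ?case using ln_le_minus_one[of "A n"] by (intro mult_left_mono) auto
  qed
qed

lemma m_lim: "filterlim (\<lambda>n. m n i) at_top sequentially"
proof -
  have "filterlim (\<lambda>n. real (m n i) / real n * real n) at_top sequentially"
    by (rule filterlim_tendsto_pos_mult_at_top[OF m \<alpha> filterlim_real_sequentially])
  moreover have "\<forall>\<^sub>F n in sequentially. real (m n i) / real n * real n = real (m n i)"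
    using eventually_gt_at_top[of 0] by eventually_elim simp
  ultimately have "filterlim (\<lambda>n. real (m n i)) at_top sequentially"
    by (simp cong: filterlim_cong)
  then show ?thesis by (simp add: filterlim_sequentially_iff_filterlim_real)
qed

lemma jump_lim: "(\<lambda>n. jump n u i / sqrt n) \<longlonglongrightarrow> zero_sum_vec i0 u $ i"
proof (cases "i = i0")
  case False
  then show ?thesis
    using tendsto_floor_div[OF sqrt_lim] by (simp add: jump_def zero_sum_vec_nth)
next
  case True
  \<comment> \<open>As the means sum to \<open>k n\<close>, the numerator is a sum of rounding
    errors, each at most 1.\<close>
  have "(\<lambda>n. (real (k n) - (\<Sum>j\<in>UNIV. base n j)) / sqrt n) \<longlonglongrightarrow> 0"
  proof (rule tendsto_rabs_zero_cancel[OF tendsto_sandwich[OF _ _ tendsto_const inv_sqrt_lim[of "real CARD('m)"]]])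
    show "\<forall>\<^sub>F n in sequentially. \<bar>(real (k n) - (\<Sum>j\<in>UNIV. base n j)) / sqrt n\<bar> \<le> real CARD('m) / sqrt n"
      using k
    proof eventually_elim
      case (elim n)
      have "real (k n) - (\<Sum>j\<in>UNIV. base n j) = (\<Sum>j\<in>UNIV. c n j * m n j - base n j)"
        by (simp add: elim[symmetric] sum_subtractf)
      also have "\<bar>\<dots>\<bar> \<le> (\<Sum>j\<in>(UNIV::'m set). 1)"
        by (intro sum_abs[THEN order_trans] sum_mono) (simp add: base_def, linarith)
      finally show ?case by (simp add: divide_right_mono)
    qed
  qed auto
  then have "(\<lambda>n. (real (k n) - (\<Sum>j\<in>UNIV. base n j)) / sqrt n + real_of_int \<lfloor>u i0 / - ln (A n)\<rfloor> / sqrt n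
      - (\<Sum>j\<in>- {i0}. \<lfloor>sqrt n * u j\<rfloor> / sqrt n)) \<longlonglongrightarrow> 0 + 0 - (\<Sum>j\<in>- {i0}. u j)"
    by (intro tendsto_intros tendsto_floor_div tendsto_floor_div_0 sqrt_lim ln_lim)
  with True show ?thesis
    by (simp add: jump_def zero_sum_vec_nth add_divide_distrib diff_divide_distrib sum_divide_distrib)
qed

lemma centred_lim: "(\<lambda>n. centred n (\<lambda>i. real_of_int (site n u i))) \<longlonglongrightarrow> zero_sum_vec i0 u"
proof (rule vec_tendstoI)
  fix i
  have "(\<lambda>n. (base n i - c n i * m n i) / sqrt n) \<longlonglongrightarrow> 0"
  proof (rule tendsto_rabs_zero_cancel[OF tendsto_sandwich[OF _ _ tendsto_const inv_sqrt_lim[of 1]]])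
    have "\<bar>real_of_int (base n i) - c n i * m n i\<bar> \<le> 1" for n
      unfolding base_def by linarith
    then show "\<forall>\<^sub>F n in sequentially. \<bar>(base n i - c n i * m n i) / sqrt n\<bar> \<le> 1 / sqrt n"
      by (intro always_eventually) (auto intro: divide_right_mono)
  qed auto
  from tendsto_add[OF this jump_lim[of u i]]
  show "(\<lambda>n. centred n (\<lambda>i. real_of_int (site n u i)) $ i) \<longlonglongrightarrow> zero_sum_vec i0 u $ i"
    by (simp add: centred_def site_def diff_divide_distrib add_divide_distrib algebra_simps)
qed

lemma base_bounds:
  assumes "0 \<le> c n i" "c n i \<le> 1"
  shows "0 \<le> base n i" "base n i \<le> int (m n i)" "\<bar>real_of_int (base n i) - c n i * m n i\<bar> \<le> 1"
proof -
  show "0 \<le> base n i" using assms by (simp add: base_def)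
  have "c n i * m n i \<le> 1 * real (m n i)" using assms by (intro mult_right_mono) auto
  then have "real_of_int (base n i) \<le> m n i" unfolding base_def by linarith
  then show "base n i \<le> int (m n i)" by linarith
  show "\<bar>real_of_int (base n i) - c n i * m n i\<bar> \<le> 1" unfolding base_def by linarith
qed

lemma ratio_lim:
  "(\<lambda>n. ratio n (site n u)) \<longlonglongrightarrow> (\<Prod>i\<in>UNIV. exp (- ((zero_sum_vec i0 u $ i)\<^sup>2 / (2 * c' i * (1 - c' i) * \<alpha> i))))"
  unfolding ratio_def
proof (rule tendsto_prod)
  fix i
  \<comment> \<open>Passing from the common scale \<open>sqrt n\<close> to the scale
    \<open>sqrt (m n i)\<close> of the block brings the factor \<open>\<alpha> i\<close> into the
    limiting variance.\<close>
  have "(\<lambda>n. (jump n u i / sqrt n) / sqrt (m n i / n)) \<longlonglongrightarrow> zero_sum_vec i0 u $ i / sqrt (\<alpha> i)"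
    using \<alpha>[of i] by (intro tendsto_intros jump_lim m) auto
  moreover have "\<forall>\<^sub>F n in sequentially. (jump n u i / sqrt n) / sqrt (m n i / n) = jump n u i / sqrt (m n i)"
    using eventually_gt_at_top[of 0] by eventually_elim (simp add: real_sqrt_divide)
  ultimately have "(\<lambda>n. jump n u i / sqrt (m n i)) \<longlonglongrightarrow> zero_sum_vec i0 u $ i / sqrt (\<alpha> i)"
    by (rule Lim_transform_eventually)
  moreover have "\<forall>\<^sub>F n in sequentially. 0 < c n i" "\<forall>\<^sub>F n in sequentially. c n i < 1"
    using c' by (auto intro!: order_tendstoD[OF c])
  then have "\<forall>\<^sub>F n in sequentially. 0 \<le> base n i \<and> base n i \<le> int (m n i) \<and> \<bar>real_of_int (base n i) - c n i * m n i\<bar> \<le> 1"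
    by eventually_elim (use base_bounds in auto)
  ultimately have "(\<lambda>n. binw (m n i) (c n i) (site n u i) / binw (m n i) (c n i) (base n i))
      \<longlonglongrightarrow> exp (- ((zero_sum_vec i0 u $ i / sqrt (\<alpha> i))\<^sup>2 / (2 * c' i * (1 - c' i))))"
    unfolding site_def using m_lim c c' by (intro binw_local_limit) auto
  then show "(\<lambda>n. binw (m n i) (c n i) (site n u i) / binw (m n i) (c n i) (base n i))
      \<longlonglongrightarrow> exp (- ((zero_sum_vec i0 u $ i)\<^sup>2 / (2 * c' i * (1 - c' i) * \<alpha> i)))"
    using \<alpha>[of i] by (simp add: power_divide mult_ac)
qed

text \<open>\<open>site n u\<close> equals \<open>y\<close> exactly for \<open>u\<close> in a box. The side \<open>i0\<close> of the box has measure
  \<open>A\<^sup>d (1 - A)\<close> under the exponential distribution, where \<open>d\<close> is the overshoot of \<open>y\<close>.\<close>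

definition cell :: "nat \<Rightarrow> ('m \<Rightarrow> int) \<Rightarrow> 'm \<Rightarrow> real \<Rightarrow> real" where
  "cell n y i t = (if i = i0
    then indicator {0..} t * (indicator {- ln (A n) * ((\<Sum>j\<in>UNIV. y j) - int (k n))
        ..< - ln (A n) * ((\<Sum>j\<in>UNIV. y j) - int (k n) + 1)} t * exp (- t))
    else indicator {(y i - base n i) / sqrt n ..< (y i - base n i + 1) / sqrt n} t)"

text \<open>By the choice of the coordinate \<open>i0\<close>, the total of \<open>site n u\<close>
  is \<open>k n\<close> plus the rounded overshoot. A lattice point is determined by its total and
  its coordinates other than \<open>i0\<close>, and each of these data restricts a single coordinate
  of \<open>u\<close>.\<close>

lemma site_eq_iff:
  "site n u = y \<longleftrightarrow> (\<forall>i\<in>- {i0}. \<lfloor>sqrt n * u i\<rfloor> = y i - base n i) \<and>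
    \<lfloor>u i0 / - ln (A n)\<rfloor> = (\<Sum>j\<in>UNIV. y j) - int (k n)"
proof -
  have split: "(\<Sum>j\<in>UNIV. f j) = f i0 + (\<Sum>j\<in>- {i0}. f j)" for f :: "'m \<Rightarrow> int"
    by (subst sum.remove[of UNIV i0]) (auto simp: Compl_eq_Diff_UNIV)
  have "(\<Sum>j\<in>UNIV. site n u j) = int (k n) + \<lfloor>u i0 / - ln (A n)\<rfloor>"
    unfolding site_def sum.distrib split[of "jump n u"] by (simp add: jump_def)
  moreover have "site n u = y" if "\<forall>i\<in>- {i0}. site n u i = y i" "(\<Sum>j\<in>UNIV. site n u j) = (\<Sum>j\<in>UNIV. y j)"
  proof
    fix i
    have "(\<Sum>j\<in>- {i0}. site n u j) = (\<Sum>j\<in>- {i0}. y j)" using that(1) by (intro sum.cong) auto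
    with that(2) have "site n u i0 = y i0" by (simp add: split)
    with that(1) show "site n u i = y i" by (cases "i = i0") auto
  qed
  moreover have "site n u i = base n i + \<lfloor>sqrt n * u i\<rfloor>" if "i \<in> - {i0}" for i
    using that by (simp add: site_def jump_def)
  ultimately show ?thesis by (metis (no_types, lifting) add.commute add_diff_cancel_left' diff_add_cancel)
qed

lemma prod_cell:
  assumes n: "0 < n" and A: "0 < A n" "A n < 1"
  shows "(\<Prod>i\<in>UNIV. cell n y i (u i)) = indicator {0..} (u i0) * exp (- u i0) * (if site n u = y then 1 else 0)"
proof -
  have ln: "- ln (A n) > 0" using A by simp
  have iff: "\<lfloor>sqrt n * t\<rfloor> = d \<longleftrightarrow> t \<in> {d / sqrt n ..< (d + 1) / sqrt n}" for t d
    using n by (simp add: floor_eq_iff field_simps)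
  have iff0: "\<lfloor>t / - ln (A n)\<rfloor> = d \<longleftrightarrow> t \<in> {- ln (A n) * d ..< - ln (A n) * (d + 1)}" for t d
    unfolding floor_eq_iff using ln by (simp only: pos_le_divide_eq pos_divide_less_eq mult.commute atLeastLessThan_iff of_int_add of_int_1)
  have "(\<Prod>i\<in>UNIV. cell n y i (u i)) = cell n y i0 (u i0) * (\<Prod>i\<in>- {i0}. cell n y i (u i))"
    by (subst prod.remove[of UNIV i0]) (auto simp: Compl_eq_Diff_UNIV)
  also have "(\<Prod>i\<in>- {i0}. cell n y i (u i)) = (\<Prod>i\<in>- {i0}. if \<lfloor>sqrt n * u i\<rfloor> = y i - base n i then 1 else 0)"
    by (intro prod.cong) (auto simp: cell_def iff indicator_def)
  also have "\<dots> = (if \<forall>i\<in>- {i0}. \<lfloor>sqrt n * u i\<rfloor> = y i - base n i then 1 else 0)"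
    by (auto intro: prod.neutral)
  also have "cell n y i0 (u i0)
      = indicator {0..} (u i0) * exp (- u i0) * (if \<lfloor>u i0 / - ln (A n)\<rfloor> = (\<Sum>j\<in>UNIV. y j) - int (k n) then 1 else 0)"
    unfolding iff0 by (simp add: cell_def indicator_def)
  finally show ?thesis by (simp add: site_eq_iff)
qed

text \<open>The part of the mass of a cell that is common to all lattice points; only the power of
  \<open>A n\<close> given by the overshoot is left out.\<close>

definition cell_mass :: "nat \<Rightarrow> real" where
  "cell_mass n = (1 - A n) * (1 / sqrt n) ^ card (- {i0})"

lemma cell_mass_pos: "0 < n \<Longrightarrow> A n < 1 \<Longrightarrow> 0 < cell_mass n"
  by (simp add: cell_mass_def)

lemma has_bochner_integral_cell:
  assumes n: "0 < n" and A: "0 < A n" "A n < 1"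
  shows "has_bochner_integral lborel (cell n y i)
    (if i = i0 then if int (k n) \<le> (\<Sum>j\<in>UNIV. y j) then A n ^ nat ((\<Sum>j\<in>UNIV. y j) - int (k n)) * (1 - A n) else 0
     else 1 / sqrt n)"
proof (cases "i = i0")
  case False
  have "has_bochner_integral lborel (indicator {(y i - base n i) / sqrt n ..< (y i - base n i + 1) / sqrt n})
      ((y i - base n i + 1) / sqrt n - (y i - base n i) / sqrt n)"
    by (intro has_bochner_integral_indicator_Ico divide_right_mono) auto
  with False show ?thesis by (simp add: cell_def[abs_def] diff_divide_distrib[symmetric])
next
  case True
  define l d where "l = - ln (A n)" and "d = (\<Sum>j\<in>UNIV. y j) - int (k n)"
  have l: "0 < l" using A by (simp add: l_def)
  show ?thesis
  proof (cases "0 \<le> d")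
    case d: True
    then have ld: "0 \<le> l * d" using l by simp
    then have "cell n y i0 = (\<lambda>t. indicator {l * d..<l * (d + 1)} t * exp (- t))"
      by (auto simp: cell_def l_def d_def indicator_def fun_eq_iff)
    moreover have "has_bochner_integral lborel (\<lambda>t. indicator {l * d..<l * (d + 1)} t * exp (- t))
        (exp (- (l * d)) - exp (- (l * (d + 1))))"
      using l by (intro has_bochner_integral_exp_Ico) auto
    moreover have "exp (- (l * d)) = A n ^ nat d"
      using d A by (simp add: l_def powr_realpow[symmetric] powr_def mult.commute)
    moreover have "exp (- (l * (d + 1))) = exp (- (l * d)) * A n"
      using A by (simp add: l_def ring_distribs exp_add)
    ultimately show ?thesis using True d by (simp add: d_def right_diff_distrib)
  next
    case d: False
    \<comment> \<open>For an integer \<open>d < 0\<close> the half-open interval ends at or before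
      0, also when \<open>d = - 1\<close>, so the exponential density vanishes on all of it.\<close>
    then have "d + 1 \<le> 0" by simp
    then have "l * real_of_int (d + 1) \<le> 0" using l by (intro mult_nonneg_nonpos) auto
    then have "cell n y i0 = (\<lambda>t. 0)"
      by (auto simp: cell_def l_def d_def indicator_def fun_eq_iff)
    then show ?thesis using True d by (simp add: d_def has_bochner_integral_zero)
  qed
qed

lemma has_bochner_integral_prod_cell:
  assumes n: "0 < n" and A: "0 < A n" "A n < 1"
  shows "has_bochner_integral (\<Pi>\<^sub>M i\<in>UNIV. lborel) (\<lambda>u. \<Prod>i\<in>UNIV. cell n y i (u i))
    (if int (k n) \<le> (\<Sum>j\<in>UNIV. y j) then A n ^ nat ((\<Sum>j\<in>UNIV. y j) - int (k n)) * cell_mass n else 0)"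
proof -
  have int: "integrable lborel (cell n y i)" for i
    using has_bochner_integral_cell[OF assms, of y i] by (auto simp: has_bochner_integral_iff)
  have "(\<integral>u. (\<Prod>i\<in>UNIV. cell n y i (u i)) \<partial>(\<Pi>\<^sub>M i\<in>UNIV. lborel)) = (\<Prod>i\<in>UNIV. integral\<^sup>L lborel (cell n y i))"
    using int by (intro product_lborel.product_integral_prod) auto
  also have "\<dots> = integral\<^sup>L lborel (cell n y i0) * (\<Prod>i\<in>- {i0}. integral\<^sup>L lborel (cell n y i))"
    by (subst prod.remove[of UNIV i0]) (auto simp: Compl_eq_Diff_UNIV)
  also have "(\<Prod>i\<in>- {i0}. integral\<^sup>L lborel (cell n y i)) = (\<Prod>i\<in>- {i0}. 1 / sqrt n)"
    by (intro prod.cong) (auto simp: has_bochner_integral_integral_eq[OF has_bochner_integral_cell[OF assms]])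
  also have "integral\<^sup>L lborel (cell n y i0)
      = (if int (k n) \<le> (\<Sum>j\<in>UNIV. y j) then A n ^ nat ((\<Sum>j\<in>UNIV. y j) - int (k n)) * (1 - A n) else 0)"
    by (simp add: has_bochner_integral_integral_eq[OF has_bochner_integral_cell[OF assms]])
  finally have "(\<integral>u. (\<Prod>i\<in>UNIV. cell n y i (u i)) \<partial>(\<Pi>\<^sub>M i\<in>UNIV. lborel)) =
     (if int (k n) \<le> (\<Sum>j\<in>UNIV. y j) then A n ^ nat ((\<Sum>j\<in>UNIV. y j) - int (k n)) * cell_mass n else 0)"
    by (simp add: cell_mass_def)
  then show ?thesis
    using int by (simp add: has_bochner_integral_iff product_lborel.product_integrable_prod)
qed

definition integrand :: "nat \<Rightarrow> (real ^ 'm \<Rightarrow> real) \<Rightarrow> ('m \<Rightarrow> real) \<Rightarrow> real" where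
  "integrand n g u = indicator {0..} (u i0) * exp (- u i0) *
    (g (centred n (\<lambda>i. real_of_int (site n u i))) * ratio n (site n u))"

text \<open>Each \<open>u\<close> lies in the cell of one lattice point at most, so a finite sum
  over cells reproduces the integrand exactly. If \<open>site n u\<close> leaves the box of possible
  values, \<open>ratio\<close> is 0 by the zero extension of \<open>binw\<close>, and so are all the
  terms of the sum.\<close>

lemma has_bochner_integral_integrand:
  assumes n: "0 < n" and A: "0 < A n" "A n < 1"
  shows "has_bochner_integral (\<Pi>\<^sub>M i\<in>UNIV. lborel) (integrand n g)
    (\<Sum>y\<in>PiE UNIV (\<lambda>i. {..m n i}). g (centred n (\<lambda>i. real (y i))) * ratio n (\<lambda>i. int (y i)) *
      (if k n \<le> (\<Sum>i\<in>UNIV. y i) then A n ^ ((\<Sum>i\<in>UNIV. y i) - k n) * cell_mass n else 0))"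
proof -
  let ?N = "PiE UNIV (\<lambda>i. {..m n i}) :: ('m \<Rightarrow> nat) set"
  have "integrand n g u = (\<Sum>y\<in>?N. g (centred n (\<lambda>i. real (y i))) * ratio n (\<lambda>i. int (y i)) *
      (\<Prod>i\<in>UNIV. cell n (\<lambda>i. int (y i)) i (u i)))" for u
  proof (cases "\<forall>i. 0 \<le> site n u i \<and> site n u i \<le> int (m n i)")
    case True
    define y where "y i = nat (site n u i)" for i
    have y: "site n u = (\<lambda>i. int (y i))" "y \<in> ?N" using True by (auto simp: y_def nat_le_iff)
    have fin: "finite ?N" by (intro finite_PiE) auto
    have "(\<Sum>x\<in>?N. g (centred n (\<lambda>i. real (x i))) * ratio n (\<lambda>i. int (x i)) *
        (\<Prod>i\<in>UNIV. cell n (\<lambda>i. int (x i)) i (u i))) =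
      (\<Sum>x\<in>?N. if x = y then g (centred n (\<lambda>i. real (x i))) * ratio n (\<lambda>i. int (x i)) *
        (indicator {0..} (u i0) * exp (- u i0)) else 0)"
      unfolding prod_cell[OF assms] y(1) by (intro sum.cong) (auto simp: fun_eq_iff)
    also have "\<dots> = integrand n g u"
      using fin y(2) by (simp add: integrand_def y(1))
    finally show ?thesis by simp
  next
    case False
    then obtain i where "site n u i < 0 \<or> int (m n i) < site n u i" by (auto simp: not_le)
    then have "ratio n (site n u) = 0"
      unfolding ratio_def by (intro prod_zero bexI[of _ i]) (auto simp: binw_eq_0)
    moreover have 0: "(\<Prod>i\<in>UNIV. cell n (\<lambda>i. int (x i)) i (u i)) = 0" if "x \<in> ?N" for x
    proof -
      have "site n u \<noteq> (\<lambda>i. int (x i))" using that False by auto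
      then show ?thesis unfolding prod_cell[OF assms] by simp
    qed
    moreover have "(\<Sum>y\<in>?N. g (centred n (\<lambda>i. real (y i))) * ratio n (\<lambda>i. int (y i)) *
        (\<Prod>i\<in>UNIV. cell n (\<lambda>i. int (y i)) i (u i))) = 0"
      by (intro sum.neutral ballI) (simp only: 0 mult_zero_right)
    ultimately show ?thesis by (simp add: integrand_def)
  qed
  then have eq: "integrand n g = (\<lambda>u. \<Sum>y\<in>?N. g (centred n (\<lambda>i. real (y i))) * ratio n (\<lambda>i. int (y i)) *
      (\<Prod>i\<in>UNIV. cell n (\<lambda>i. int (y i)) i (u i)))" by blast
  have "has_bochner_integral (\<Pi>\<^sub>M i\<in>UNIV. lborel) (\<lambda>u. \<Prod>i\<in>UNIV. cell n (\<lambda>i. int (y i)) i (u i))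
    (if k n \<le> (\<Sum>i\<in>UNIV. y i) then A n ^ ((\<Sum>i\<in>UNIV. y i) - k n) * cell_mass n else 0)" for y :: "'m \<Rightarrow> nat"
  proof -
    have "int (k n) \<le> (\<Sum>j\<in>UNIV. int (y j)) \<longleftrightarrow> k n \<le> (\<Sum>i\<in>UNIV. y i)"
      by (simp only: of_nat_sum[symmetric] of_nat_le_iff)
    moreover have "nat ((\<Sum>j\<in>UNIV. int (y j)) - int (k n)) = (\<Sum>i\<in>UNIV. y i) - k n"
      by (simp only: of_nat_sum[symmetric] nat_minus_as_int[symmetric])
    ultimately show ?thesis
      using has_bochner_integral_prod_cell[OF assms, of "\<lambda>i. int (y i)"] by (simp only:)
  qed
  then show ?thesis
    unfolding eq by (intro has_bochner_integral_sum has_bochner_integral_mult_right)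
qed

text \<open>Supplies the majorant. The displacement at \<open>i0\<close> mixes all coordinates of
  \<open>u\<close>, so its factor is merely bounded by a constant; integrability in
  \<open>u i0\<close> comes from the exponential density.\<close>

lemma ratio_bounds:
  fixes \<epsilon> :: real
  assumes n: "0 < n" and e: "0 < \<epsilon>" "\<And>i. \<epsilon> \<le> c n i" "\<And>i. c n i \<le> 1 - \<epsilon>"
    and m: "\<And>i. 0 < m n i" "\<And>i. m n i \<le> n"
  shows "0 \<le> ratio n (site n u)"
    "ratio n (site n u) \<le> exp (2 / \<epsilon> + 2) ^ CARD('m) * (\<Prod>i\<in>- {i0}. exp (- (1 / 4 * (u i)\<^sup>2)))"
proof -
  have c01: "0 < c n i" "c n i < 1" for i using e(1) e(2,3)[of i] by linarith+
  let ?r = "\<lambda>i. binw (m n i) (c n i) (site n u i) / binw (m n i) (c n i) (base n i)"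
  have pos: "0 \<le> ?r i" for i using c01[of i] by (simp add: binw_nonneg)
  then show "0 \<le> ratio n (site n u)" unfolding ratio_def by (intro prod_nonneg) auto
  have le: "?r i \<le> exp (2 / \<epsilon> + 1) * exp (- (real_of_int (jump n u i))\<^sup>2 / (2 * real n))" for i
  proof -
    have base: "0 < binw (m n i) (c n i) (base n i)"
      using c01[of i] base_bounds[of n i] by (intro binw_pos) auto
    have "binw (m n i) (c n i) (site n u i) \<le> binw (m n i) (c n i) (base n i) *
        (exp (1 / c n i + 1 / (1 - c n i) + 1) * exp (- (real_of_int (jump n u i))\<^sup>2 / (2 * real (m n i))))"
      unfolding site_def using c01[of i] base_bounds[of n i] m(1)[of i] by (intro binw_gauss) auto
    then have "?r i \<le> exp (1 / c n i + 1 / (1 - c n i) + 1) * exp (- (real_of_int (jump n u i))\<^sup>2 / (2 * real (m n i)))"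
      using base by (simp add: divide_le_eq mult.commute)
    also have "\<dots> \<le> exp (2 / \<epsilon> + 1) * exp (- (real_of_int (jump n u i))\<^sup>2 / (2 * real n))"
    proof (intro mult_mono)
      have "1 / c n i \<le> 1 / \<epsilon>" "1 / (1 - c n i) \<le> 1 / \<epsilon>"
        using e(1) e(2,3)[of i] by (intro divide_left_mono; auto)+
      then show "exp (1 / c n i + 1 / (1 - c n i) + 1) \<le> exp (2 / \<epsilon> + 1)" by simp
      \<comment> \<open>Enlarging \<open>m n i\<close> to \<open>n\<close> weakens the Gaussian but
        matches the scale \<open>sqrt n\<close> of \<open>jump\<close>.\<close>
      have "(real_of_int (jump n u i))\<^sup>2 / (2 * real n) \<le> (real_of_int (jump n u i))\<^sup>2 / (2 * real (m n i))"
        using m[of i] n by (intro divide_left_mono) auto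
      then show "exp (- (real_of_int (jump n u i))\<^sup>2 / (2 * real (m n i))) \<le> exp (- (real_of_int (jump n u i))\<^sup>2 / (2 * real n))"
        by simp
    qed auto
    finally show ?thesis .
  qed
  have K: "exp (2 / \<epsilon> + 1) \<le> exp (2 / \<epsilon> + 2)" by simp
  have "?r i0 \<le> exp (2 / \<epsilon> + 1) * 1"
    by (rule order_trans[OF le]) (intro mult_left_mono; simp)
  then have r0: "?r i0 \<le> exp (2 / \<epsilon> + 2)" using K by linarith
  have r: "?r i \<le> exp (2 / \<epsilon> + 2) * exp (- (1 / 4 * (u i)\<^sup>2))" if "i \<in> - {i0}" for i
  proof -
    \<comment> \<open>Rounding costs at most 1, so the square of \<open>v\<close> is at most twice
      that of its floor plus 2. Division by \<open>4 * n\<close> gives the exponent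
      \<open>1 / 4\<close> and a constant below 1, which turns \<open>2 / \<epsilon> + 1\<close>
      into \<open>2 / \<epsilon> + 2\<close>.\<close>
    define v where "v = sqrt n * u i"
    have "\<bar>v\<bar> \<le> \<bar>real_of_int \<lfloor>v\<rfloor>\<bar> + 1" by linarith
    then have "v\<^sup>2 \<le> (\<bar>real_of_int \<lfloor>v\<rfloor>\<bar> + 1)\<^sup>2"
      using power_mono[of "\<bar>v\<bar>" _ 2] by simp
    also have "\<dots> \<le> 2 * (real_of_int \<lfloor>v\<rfloor>)\<^sup>2 + 2"
      using sum_squares_bound[of "\<bar>real_of_int \<lfloor>v\<rfloor>\<bar>" 1] by (simp add: power2_sum)
    finally have "n * (u i)\<^sup>2 \<le> 2 * (real_of_int \<lfloor>v\<rfloor>)\<^sup>2 + 2"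
      by (simp add: v_def power_mult_distrib)
    then have "(u i)\<^sup>2 \<le> (2 * (real_of_int \<lfloor>v\<rfloor>)\<^sup>2 + 2) / n"
      using n by (simp add: le_divide_eq mult.commute)
    also have "\<dots> = 4 * ((real_of_int \<lfloor>v\<rfloor>)\<^sup>2 / (2 * real n)) + 2 / n"
      by (simp add: add_divide_distrib)
    also have "2 / real n \<le> 2" using n by (simp add: divide_le_eq)
    finally have "- (real_of_int (jump n u i))\<^sup>2 / (2 * real n) \<le> 1 + - (1 / 4 * (u i)\<^sup>2)"
      using that by (simp add: jump_def v_def)
    then have "exp (2 / \<epsilon> + 1) * exp (- (real_of_int (jump n u i))\<^sup>2 / (2 * real n))
        \<le> exp (2 / \<epsilon> + 1) * exp (1 + - (1 / 4 * (u i)\<^sup>2))" by simp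
    also have "\<dots> = exp (2 / \<epsilon> + 2) * exp (- (1 / 4 * (u i)\<^sup>2))"
      by (simp add: exp_add[symmetric])
    finally show ?thesis using le[of i] by linarith
  qed
  have "ratio n (site n u) = ?r i0 * (\<Prod>i\<in>- {i0}. ?r i)"
    unfolding ratio_def by (subst prod.remove[of UNIV i0]) (auto simp: Compl_eq_Diff_UNIV)
  also have "\<dots> \<le> exp (2 / \<epsilon> + 2) * (\<Prod>i\<in>- {i0}. exp (2 / \<epsilon> + 2) * exp (- (1 / 4 * (u i)\<^sup>2)))"
    using r r0 pos by (intro mult_mono prod_mono prod_nonneg) auto
  also have "\<dots> = exp (2 / \<epsilon> + 2) ^ Suc (card (- {i0})) * (\<Prod>i\<in>- {i0}. exp (- (1 / 4 * (u i)\<^sup>2)))"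
    by (simp only: prod.distrib prod_constant power_Suc mult.assoc)
  also have "Suc (card (- {i0})) = CARD('m)"
    using card_Suc_Diff1[of UNIV i0] by (simp add: Compl_eq_Diff_UNIV)
  finally show "ratio n (site n u) \<le> exp (2 / \<epsilon> + 2) ^ CARD('m) * (\<Prod>i\<in>- {i0}. exp (- (1 / 4 * (u i)\<^sup>2)))" .
qed

section \<open>Dominated convergence to the Gaussian integral\<close>

definition gauss :: "real ^ 'm \<Rightarrow> real" where
  "gauss z = (\<Prod>i\<in>UNIV. exp (- ((z $ i)\<^sup>2 / (2 * c' i * (1 - c' i) * \<alpha> i))))"

lemma continuous_gauss: "continuous_on UNIV gauss"
  unfolding gauss_def[abs_def] using c' \<alpha>
  by (intro continuous_intros) (auto simp: less_imp_neq[symmetric])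

theorem integrand_tendsto:
  fixes g :: "real ^ 'm \<Rightarrow> real"
  assumes g: "continuous_on UNIV g" and bdd: "\<And>z. \<bar>g z\<bar> \<le> B"
  shows "integrable (\<Pi>\<^sub>M i\<in>UNIV. (lborel :: real measure))
      (\<lambda>u. indicator {0..} (u i0) * exp (- u i0) * (g (zero_sum_vec i0 u) * gauss (zero_sum_vec i0 u)))"
    and "(\<lambda>n. \<integral>u. integrand n g u \<partial>(\<Pi>\<^sub>M i\<in>UNIV. (lborel :: real measure)))
      \<longlonglongrightarrow> (\<integral>z. g z * gauss z \<partial>param_lborel (- {i0}) (\<lambda>i. axis i 1 - axis i0 1))"
proof -
  let ?M = "\<Pi>\<^sub>M i\<in>UNIV. (lborel :: real measure)"
  let ?f = "\<lambda>u. indicator {0..} (u i0) * exp (- u i0) * (g (zero_sum_vec i0 u) * gauss (zero_sum_vec i0 u))"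
  \<comment> \<open>Half the least distance of the limits \<open>c' i\<close> from 0 and 1, so that
    eventually all \<open>c n i\<close> stay between \<open>\<epsilon>\<close> and
    \<open>1 - \<epsilon>\<close>.\<close>
  define \<epsilon> where "\<epsilon> = Min (range (\<lambda>i. min (c' i) (1 - c' i))) / 2"
  have "0 < \<epsilon>" using c' by (simp add: \<epsilon>_def)
  have e_le: "2 * \<epsilon> \<le> min (c' i) (1 - c' i)" for i
    using Min_le[of "range (\<lambda>i. min (c' i) (1 - c' i))" "min (c' i) (1 - c' i)"]
    unfolding \<epsilon>_def by simp
  have e: "\<epsilon> < c' i" "c' i < 1 - \<epsilon>" for i
    using e_le[of i] \<open>0 < \<epsilon>\<close> by auto
  define good where "good n \<longleftrightarrow> 0 < n \<and> 0 < A n \<and> A n < 1 \<and>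
    (\<forall>i. 0 < m n i \<and> m n i \<le> n \<and> \<epsilon> \<le> c n i \<and> c n i \<le> 1 - \<epsilon>)" for n
  have "\<forall>\<^sub>F n in sequentially. \<forall>i. 0 < m n i \<and> \<epsilon> \<le> c n i \<and> c n i \<le> 1 - \<epsilon>"
  proof (rule eventually_all_finite)
    fix i
    have "\<forall>\<^sub>F n in sequentially. 1 \<le> m n i" using m_lim[of i] by (simp add: filterlim_at_top)
    moreover have "\<forall>\<^sub>F n in sequentially. \<epsilon> < c n i" "\<forall>\<^sub>F n in sequentially. c n i < 1 - \<epsilon>"
      using e by (auto intro!: order_tendstoD[OF c])
    ultimately show "\<forall>\<^sub>F n in sequentially. 0 < m n i \<and> \<epsilon> \<le> c n i \<and> c n i \<le> 1 - \<epsilon>"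
      by eventually_elim auto
  qed
  then have good: "\<forall>\<^sub>F n in sequentially. good n"
    using A01 m_le eventually_gt_at_top[of 0] by eventually_elim (auto simp: good_def)
  \<comment> \<open>Dominated convergence asks for a bound at every index, while the estimates hold
    for good \<open>n\<close> only; setting the integrand to 0 elsewhere does not affect the
    limit.\<close>
  define s where "s n = (if good n then integrand n g else (\<lambda>_. 0))" for n
  define w where "w i t = (if i = i0 then indicator {0..} t * exp (- t) else exp (- (1 / 4 * t\<^sup>2)))" for i and t :: real
  have w: "integrable lborel (w i)" for i
    using has_bochner_integral_exp_Ici integrable_exp_square[of "1 / 4"]
    by (cases "i = i0") (auto simp: w_def[abs_def] has_bochner_integral_iff)
  have w_int: "integrable ?M (\<lambda>u. B * exp (2 / \<epsilon> + 2) ^ CARD('m) * (\<Prod>i\<in>UNIV. w i (u i)))"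
    using w by (intro integrable_mult_right product_lborel.product_integrable_prod) auto
  have s_meas: "s n \<in> borel_measurable ?M" for n
    using has_bochner_integral_integrand[of n g, THEN borel_measurable_has_bochner_integral]
    by (auto simp: s_def good_def)
  have [measurable]: "g \<in> borel_measurable borel" "gauss \<in> borel_measurable borel"
    using g continuous_gauss by (auto intro: borel_measurable_continuous_onI)
  have [measurable]: "zero_sum_vec i0 \<in> borel_measurable ?M"
    by (rule zero_sum_vec_measurable) auto
  have f_meas: "?f \<in> borel_measurable ?M" by measurable
  have lim: "(\<lambda>n. s n u) \<longlonglongrightarrow> ?f u" for u
  proof -
    have "(\<lambda>n. integrand n g u) \<longlonglongrightarrow> ?f u"
      unfolding integrand_def gauss_def
      by (intro tendsto_intros ratio_lim continuous_on_tendsto_compose[OF g centred_lim]) auto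
    moreover have "\<forall>\<^sub>F n in sequentially. integrand n g u = s n u"
      using good by eventually_elim (simp add: s_def)
    ultimately show ?thesis by (rule Lim_transform_eventually)
  qed
  have bound: "norm (s n u) \<le> B * exp (2 / \<epsilon> + 2) ^ CARD('m) * (\<Prod>i\<in>UNIV. w i (u i))" for n u
  proof (cases "good n")
    case True
    have "0 \<le> B" using bdd[of 0] by linarith
    define R where "R = exp (2 / \<epsilon> + 2) ^ CARD('m) * (\<Prod>i\<in>- {i0}. exp (- (1 / 4 * (u i)\<^sup>2)))"
    have "0 < n" "\<And>i. \<epsilon> \<le> c n i" "\<And>i. c n i \<le> 1 - \<epsilon>" "\<And>i. 0 < m n i" "\<And>i. m n i \<le> n"
      using True by (auto simp: good_def)
    note bounds = ratio_bounds[OF this(1) \<open>0 < \<epsilon>\<close> this(2-5)]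
    have R: "0 \<le> ratio n (site n u)" "ratio n (site n u) \<le> R"
      unfolding R_def by (rule bounds)+
    have "norm (s n u) = indicator {0..} (u i0) * exp (- u i0) *
        (\<bar>g (centred n (\<lambda>i. real_of_int (site n u i)))\<bar> * ratio n (site n u))"
      using True R(1) by (simp add: s_def integrand_def abs_mult)
    also have "\<dots> \<le> indicator {0..} (u i0) * exp (- u i0) * (B * R)"
      using R bdd \<open>0 \<le> B\<close> by (intro mult_left_mono mult_mono) auto
    also have "\<dots> = B * exp (2 / \<epsilon> + 2) ^ CARD('m) * (w i0 (u i0) * (\<Prod>i\<in>- {i0}. exp (- (1 / 4 * (u i)\<^sup>2))))"
      by (simp add: w_def R_def)
    also have "(\<Prod>i\<in>- {i0}. exp (- (1 / 4 * (u i)\<^sup>2))) = (\<Prod>i\<in>- {i0}. w i (u i))"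
      by (intro prod.cong) (auto simp: w_def)
    also have "w i0 (u i0) * (\<Prod>i\<in>- {i0}. w i (u i)) = (\<Prod>i\<in>UNIV. w i (u i))"
      by (subst prod.remove[of UNIV i0]) (auto simp: Compl_eq_Diff_UNIV)
    finally show ?thesis .
  next
    case False
    have "0 \<le> B" using bdd[of 0] by linarith
    moreover have "0 \<le> (\<Prod>i\<in>UNIV. w i (u i))" by (intro prod_nonneg) (auto simp: w_def)
    ultimately show ?thesis using False by (simp add: s_def)
  qed
  show int: "integrable ?M ?f"
    by (rule integrable_dominated_convergence[where s = s, OF f_meas s_meas w_int AE_I2[OF lim] AE_I2[OF bound]])
  have s_lim: "(\<lambda>n. integral\<^sup>L ?M (s n)) \<longlonglongrightarrow> integral\<^sup>L ?M ?f"
    by (rule integral_dominated_convergence[OF f_meas s_meas w_int AE_I2[OF lim] AE_I2[OF bound]])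
  have f_eq: "integral\<^sup>L ?M ?f = (\<integral>z. g z * gauss z \<partial>param_lborel (- {i0}) (\<lambda>i. axis i 1 - axis i0 1))"
    by (rule integral_exponential_coordinate[OF int]) measurable
  have "\<forall>\<^sub>F n in sequentially. integral\<^sup>L ?M (s n) = integral\<^sup>L ?M (integrand n g)"
    using good by eventually_elim (simp add: s_def)
  from Lim_transform_eventually[OF s_lim this]
  show "(\<lambda>n. \<integral>u. integrand n g u \<partial>?M)
      \<longlonglongrightarrow> (\<integral>z. g z * gauss z \<partial>param_lborel (- {i0}) (\<lambda>i. axis i 1 - axis i0 1))"
    by (simp only: f_eq)
qed

end

section \<open>Conditional laws and the normalised limit density\<close>

context tilted_blocks
begin

lemma conditional_expectation_eq:
  fixes X :: "'m \<Rightarrow> 'w \<Rightarrow> nat" and g :: "real ^ 'm \<Rightarrow> real"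
  assumes M: "prob_space M" and indep: "prob_space.indep_vars M (\<lambda>_. count_space UNIV) X UNIV"
    and distr: "\<And>i. distr M (count_space UNIV) (X i) = measure_pmf (binomial_pmf (m n i) (p i))"
    and p: "\<And>i. 0 < p i" "\<And>i. p i < 1" and n: "0 < n" and A: "0 < A n" "A n < 1"
    and c: "\<And>i. 0 < c n i" "\<And>i. c n i < 1"
    and odds: "\<And>i. (1 - c n i) * p i = A n * (c n i * (1 - p i))"
    and nonzero: "(\<integral>u. integrand n (\<lambda>_. 1) u \<partial>(\<Pi>\<^sub>M i\<in>UNIV. (lborel :: real measure))) \<noteq> 0"
    and g [measurable]: "g \<in> borel_measurable borel"
  shows "(\<integral>x. g x \<partial>distr (uniform_measure M {\<omega> \<in> space M. k n \<le> (\<Sum>i\<in>UNIV. X i \<omega>)}) borel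
        (\<lambda>\<omega>. centred n (\<lambda>i. real (X i \<omega>))))
    = (\<integral>u. integrand n g u \<partial>(\<Pi>\<^sub>M i\<in>UNIV. (lborel :: real measure)))
      / (\<integral>u. integrand n (\<lambda>_. 1) u \<partial>(\<Pi>\<^sub>M i\<in>UNIV. (lborel :: real measure)))"
proof -
  interpret prob_space M by fact
  let ?N = "PiE UNIV (\<lambda>i. {..m n i}) :: ('m \<Rightarrow> nat) set"
  let ?S = "\<lambda>y :: 'm \<Rightarrow> nat. \<Sum>i\<in>UNIV. y i"
  define E where "E = {\<omega> \<in> space M. k n \<le> (\<Sum>i\<in>UNIV. X i \<omega>)}"
  have "random_variable (count_space UNIV) (X i)" for i
    using indep by (auto simp: indep_vars_def)
  then have V: "random_variable (count_space UNIV) (\<lambda>\<omega> i. X i \<omega>)"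
    by (rule random_variable_nat_vector)
  have fun_V: "(\<lambda>\<omega>. F (\<lambda>i. X i \<omega>)) \<in> measurable M borel" for F :: "('m \<Rightarrow> nat) \<Rightarrow> 'z::topological_space"
    using V by (rule measurable_compose) auto
  have "E = (\<lambda>\<omega> i. X i \<omega>) -` {y. k n \<le> ?S y} \<inter> space M" by (auto simp: E_def)
  also have "\<dots> \<in> events" using V by (rule measurable_sets) auto
  finally have E [measurable]: "E \<in> events" .
  define T where "T g = (\<Sum>y\<in>?N. g (centred n (\<lambda>i. real (y i))) * ratio n (\<lambda>i. int (y i)) *
      (if k n \<le> ?S y then A n ^ (?S y - k n) else 0))" for g
  have integrand: "(\<integral>u. integrand n g u \<partial>(\<Pi>\<^sub>M i\<in>UNIV. (lborel :: real measure))) = cell_mass n * T g" for g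
    unfolding has_bochner_integral_integral_eq[OF has_bochner_integral_integrand[OF n A]] T_def sum_distrib_left
    by (intro sum.cong) auto
  \<comment> \<open>Collects what does not depend on the lattice point: the factors per trial,
    \<open>A n\<close> to the power of the level, and the reference weights. It appears in the
    probability of the event as well and cancels.\<close>
  define D where "D = (\<Prod>i\<in>UNIV. ((1 - p i) / (1 - c n i)) ^ m n i) * A n ^ k n *
      (\<Prod>i\<in>UNIV. binw (m n i) (c n i) (base n i))"
  have base_pos: "0 < binw (m n i) (c n i) (base n i)" for i
    using c[of i] base_bounds[of n i] by (intro binw_pos) auto
  have "0 < D"
    unfolding D_def using p c A base_pos by (intro mult_pos_pos prod_pos) auto
  have weight: "(\<Prod>i\<in>UNIV. pmf (binomial_pmf (m n i) (p i)) (y i)) = D * (ratio n (\<lambda>i. int (y i)) * A n ^ (?S y - k n))"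
    if y: "y \<in> ?N" "k n \<le> ?S y" for y
  proof -
    have "(\<Prod>i\<in>UNIV. pmf (binomial_pmf (m n i) (p i)) (y i))
        = (\<Prod>i\<in>UNIV. ((1 - p i) / (1 - c n i)) ^ m n i * (A n ^ y i * binw (m n i) (c n i) (int (y i))))"
    proof (rule prod.cong[OF refl])
      fix i
      have "y i \<le> m n i" using y(1) by auto
      from pmf_binomial_tilt[OF p c odds this]
      show "pmf (binomial_pmf (m n i) (p i)) (y i)
          = ((1 - p i) / (1 - c n i)) ^ m n i * (A n ^ y i * binw (m n i) (c n i) (int (y i)))"
        by (simp only: binw_def of_nat_0_le_iff if_True nat_int)
    qed
    also have "\<dots> = (\<Prod>i\<in>UNIV. ((1 - p i) / (1 - c n i)) ^ m n i) * (A n ^ ?S y * (\<Prod>i\<in>UNIV. binw (m n i) (c n i) (int (y i))))"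
      by (simp add: prod.distrib power_sum)
    also have "A n ^ ?S y = A n ^ k n * A n ^ (?S y - k n)"
      using y(2) by (simp add: power_add[symmetric])
    also have "(\<Prod>i\<in>UNIV. binw (m n i) (c n i) (int (y i)))
        = (\<Prod>i\<in>UNIV. binw (m n i) (c n i) (base n i)) * ratio n (\<lambda>i. int (y i))"
      unfolding ratio_def prod.distrib[symmetric] using base_pos by (intro prod.cong) (auto simp: less_imp_neq[symmetric])
    finally show ?thesis by (simp add: D_def mult_ac)
  qed
  have expect: "expectation (\<lambda>\<omega>. indicator E \<omega> * g (centred n (\<lambda>i. real (X i \<omega>)))) = D * T g" for g
  proof -
    have "expectation (\<lambda>\<omega>. indicator E \<omega> * g (centred n (\<lambda>i. real (X i \<omega>))))
        = expectation (\<lambda>\<omega>. (\<lambda>y. if k n \<le> ?S y then g (centred n (\<lambda>i. real (y i))) else 0) (\<lambda>i. X i \<omega>))"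
      by (intro Bochner_Integration.integral_cong) (auto simp: E_def indicator_def)
    also have "\<dots> = (\<Sum>y\<in>?N. (if k n \<le> ?S y then g (centred n (\<lambda>i. real (y i))) else 0) *
        (\<Prod>i\<in>UNIV. pmf (binomial_pmf (m n i) (p i)) (y i)))"
      by (rule expectation_binomial_vector[OF indep distr p])
    also have "\<dots> = D * T g"
      unfolding T_def sum_distrib_left by (intro sum.cong) (auto simp: weight simp del: pmf_binomial)
    finally show ?thesis .
  qed
  have prob_E: "prob E = D * T (\<lambda>_. 1)"
    using expect[of "\<lambda>_. 1"] E by simp
  \<comment> \<open>This makes the probability of the event nonzero, so that conditioning on it is a
    division by \<open>prob E\<close>.\<close>
  have T1: "T (\<lambda>_. 1) \<noteq> 0" using nonzero integrand[of "\<lambda>_. 1"] by auto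
  have "(\<integral>x. g x \<partial>distr (uniform_measure M E) borel (\<lambda>\<omega>. centred n (\<lambda>i. real (X i \<omega>))))
      = (\<integral>\<omega>. g (centred n (\<lambda>i. real (X i \<omega>))) \<partial>uniform_measure M E)"
    using fun_V[of "\<lambda>y. centred n (\<lambda>i. real (y i))"] by (subst integral_distr) (auto cong: measurable_cong_sets)
  also have "\<dots> = expectation (\<lambda>\<omega>. indicator E \<omega> * g (centred n (\<lambda>i. real (X i \<omega>)))) / prob E"
    using T1 \<open>0 < D\<close> prob_E fun_V[of "\<lambda>y. g (centred n (\<lambda>i. real (y i)))"]
    by (intro integral_uniform_measure) auto
  also have "\<dots> = (cell_mass n * T g) / (cell_mass n * T (\<lambda>_. 1))"
    using \<open>0 < D\<close> cell_mass_pos[OF n A(2)] by (simp add: expect prob_E)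
  finally show ?thesis unfolding integrand E_def .
qed

lemma gauss_pos: "0 < gauss z"
  unfolding gauss_def by (intro prod_pos) auto

text \<open>In the chart the factor of \<open>gauss\<close> at \<open>i0\<close> is at most 1;
  dropping it leaves a product of one-dimensional Gaussians.\<close>

lemma integrable_gauss:
  fixes g :: "real ^ 'm \<Rightarrow> real"
  assumes g [measurable]: "g \<in> borel_measurable borel" and bdd: "\<And>z. \<bar>g z\<bar> \<le> B"
  shows "integrable (param_lborel (- {i0}) (\<lambda>i. axis i 1 - axis i0 1)) (\<lambda>z. g z * gauss z)"
proof -
  let ?M = "\<Pi>\<^sub>M i\<in>- {i0}. (lborel :: real measure)"
  define s where "s i = 1 / (2 * c' i * (1 - c' i) * \<alpha> i)" for i
  have s: "0 < s i" for i using c'[of i] \<alpha>[of i] by (simp add: s_def)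
  have gauss: "gauss z = (\<Prod>i\<in>UNIV. exp (- (s i * (z $ i)\<^sup>2)))" for z
    by (simp add: gauss_def s_def)
  have [measurable]: "gauss \<in> borel_measurable borel"
    using continuous_gauss by (rule borel_measurable_continuous_onI)
  have [measurable]: "zero_sum_vec i0 \<in> borel_measurable ?M"
    by (rule zero_sum_vec_measurable) auto
  have bound: "\<bar>g (zero_sum_vec i0 u) * gauss (zero_sum_vec i0 u)\<bar> \<le> B * (\<Prod>i\<in>- {i0}. exp (- (s i * (u i)\<^sup>2)))" for u
  proof -
    have "gauss (zero_sum_vec i0 u)
        = exp (- (s i0 * (zero_sum_vec i0 u $ i0)\<^sup>2)) * (\<Prod>i\<in>- {i0}. exp (- (s i * (zero_sum_vec i0 u $ i)\<^sup>2)))"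
      unfolding gauss by (subst prod.remove[of UNIV i0]) (auto simp: Compl_eq_Diff_UNIV)
    also have "\<dots> \<le> 1 * (\<Prod>i\<in>- {i0}. exp (- (s i * (zero_sum_vec i0 u $ i)\<^sup>2)))"
      using s[of i0] by (intro mult_right_mono prod_nonneg) auto
    also have "\<dots> = (\<Prod>i\<in>- {i0}. exp (- (s i * (u i)\<^sup>2)))"
      by (simp, intro prod.cong) (auto simp: zero_sum_vec_nth)
    finally show ?thesis
      unfolding abs_mult using gauss_pos[of "zero_sum_vec i0 u"] bdd order_trans[OF abs_ge_zero bdd]
      by (intro mult_mono) auto
  qed
  have "integrable ?M (\<lambda>u. B * (\<Prod>i\<in>- {i0}. exp (- (s i * (u i)\<^sup>2))))"
    using s by (intro integrable_mult_right product_lborel.product_integrable_prod integrable_exp_square) auto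
  then have "integrable ?M (\<lambda>u. g (zero_sum_vec i0 u) * gauss (zero_sum_vec i0 u))"
    by (rule Bochner_Integration.integrable_bound) (use bound in \<open>auto intro: order_trans[OF _ abs_ge_self]\<close>)
  then show ?thesis
    unfolding param_lborel_zero_sum_vec by (subst integrable_distr_eq) auto
qed

text \<open>A vanishing integral of the positive function \<open>gauss\<close> would make the whole
  space a null set, but the unit ball has positive measure.\<close>

lemma integral_gauss_pos:
  "0 < (\<integral>z. gauss z \<partial>param_lborel (- {i0}) (\<lambda>i. axis i 1 - axis i0 1))"
proof -
  let ?\<nu> = "param_lborel (- {i0}) (\<lambda>i. axis i 1 - axis i0 1) :: (real ^ 'm) measure"
  have int: "integrable ?\<nu> gauss" using integrable_gauss[of "\<lambda>_. 1" 1] by simp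
  have "integral\<^sup>L ?\<nu> gauss \<noteq> 0"
  proof
    assume "integral\<^sup>L ?\<nu> gauss = 0"
    then have "AE z in ?\<nu>. gauss z = 0"
      using integral_nonneg_eq_0_iff_AE[OF int] gauss_pos by (auto simp: less_imp_le)
    then have "AE z in ?\<nu>. False"
      by (rule eventually_mono) (use gauss_pos in \<open>auto simp: less_le\<close>)
    then obtain N where N: "{z \<in> space ?\<nu>. \<not> False} \<subseteq> N" "emeasure ?\<nu> N = 0" "N \<in> sets ?\<nu>"
      by (rule AE_E)
    have "space ?\<nu> = UNIV" by (simp add: param_lborel_def)
    with N(1) have "cball 0 1 \<subseteq> N" by blast
    from emeasure_eq_0[OF N(3,2) this] have "emeasure ?\<nu> (cball 0 1) = 0" .
    moreover have "0 < emeasure ?\<nu> (cball 0 1)"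
      by (rule emeasure_param_lborel_cball(2)[where w = "\<lambda>j. axis j 1"])
         (auto simp: inner_diff_left inner_axis_axis)
    ultimately show False by simp
  qed
  moreover have "0 \<le> integral\<^sup>L ?\<nu> gauss"
    using gauss_pos by (intro Bochner_Integration.integral_nonneg) (auto simp: less_imp_le)
  ultimately show ?thesis by simp
qed

text \<open>The quantifiers are ordered so that one \<open>C\<close> serves every \<open>g\<close>:
  it has to cancel between \<open>g\<close> and the constant 1.\<close>

lemma nu0_limit_fun:
  "\<exists>C>0. \<forall>g B. g \<in> borel_measurable borel \<longrightarrow> (\<forall>z. \<bar>g z\<bar> \<le> B) \<longrightarrow>
    integrable nu0 (\<lambda>z. g z * limit_fun c' \<alpha> z) \<and>
    (\<integral>z. g z * limit_fun c' \<alpha> z \<partial>nu0) = C * (\<integral>z. g z * gauss z \<partial>param_lborel (- {i0}) (\<lambda>i. axis i 1 - axis i0 1))"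
proof -
  let ?\<nu> = "param_lborel (- {i0}) (\<lambda>i. axis i 1 - axis i0 1) :: (real ^ 'm) measure"
  obtain C where C: "0 < C" "(nu0 :: (real ^ 'm) measure) = density ?\<nu> (\<lambda>_. ennreal C)"
    using nu0_proportional[of i0] unfolding scale_measure_eq_density by metis
  have gauss_meas [measurable]: "gauss \<in> borel_measurable borel"
    using continuous_gauss by (rule borel_measurable_continuous_onI)
  have "closed (S0 :: (real ^ 'm) set)"
    unfolding S0_def by (intro closed_Collect_eq continuous_intros)
  then have [measurable]: "(S0 :: (real ^ 'm) set) \<in> sets borel" by simp
  have f: "limit_fun c' \<alpha> z = indicator S0 z * gauss z" for z
    by (simp add: limit_fun_def gauss_def)
  \<comment> \<open>The chart measure is carried by \<open>S0\<close>, so the indicator in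
    \<open>limit_fun\<close> is 1 almost everywhere and the continuous \<open>gauss\<close>
    remains.\<close>
  have "zero_sum_vec i0 u \<in> S0" for u
    by (simp add: S0_def zero_sum_vec_nth sum.remove[of UNIV i0] Compl_eq_Diff_UNIV)
  then have AE: "AE z in ?\<nu>. z \<in> S0"
    unfolding param_lborel_zero_sum_vec by (subst AE_distr_iff) (auto intro!: zero_sum_vec_measurable)
  have fm [measurable]: "limit_fun c' \<alpha> \<in> borel_measurable borel"
    unfolding f[abs_def] by measurable
  show ?thesis
  proof (intro exI[of _ C] conjI allI impI C(1))
    fix g :: "real ^ 'm \<Rightarrow> real" and B
    assume g [measurable]: "g \<in> borel_measurable borel" and "\<forall>z. \<bar>g z\<bar> \<le> B"
    then have bdd: "\<And>z. \<bar>g z\<bar> \<le> B" by blast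
    have eq: "AE z in ?\<nu>. C *\<^sub>R (g z * limit_fun c' \<alpha> z) = C * (g z * gauss z)"
      using AE by eventually_elim (simp add: f)
    have "integrable ?\<nu> (\<lambda>z. C *\<^sub>R (g z * limit_fun c' \<alpha> z)) = integrable ?\<nu> (\<lambda>z. C * (g z * gauss z))"
      by (rule integrable_cong_AE[OF _ _ eq]) measurable
    then show "integrable nu0 (\<lambda>z. g z * limit_fun c' \<alpha> z)"
      unfolding C(2) using C(1) integrable_gauss[OF g bdd] by (subst integrable_density) auto
    have "(\<integral>z. C *\<^sub>R (g z * limit_fun c' \<alpha> z) \<partial>?\<nu>) = (\<integral>z. C * (g z * gauss z) \<partial>?\<nu>)"
      by (rule integral_cong_AE[OF _ _ eq]) measurable
    then show "(\<integral>z. g z * limit_fun c' \<alpha> z \<partial>nu0) = C * (\<integral>z. g z * gauss z \<partial>?\<nu>)"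
      unfolding C(2) using C(1) by (subst integral_density) auto
  qed
qed

lemma prob_space_limit:
  "prob_space (density nu0 (\<lambda>z. ennreal (limit_fun c' \<alpha> z / (\<integral>x. limit_fun c' \<alpha> x \<partial>nu0))))"
  and integral_limit: "continuous_on UNIV g \<Longrightarrow> (\<And>z. \<bar>g z\<bar> \<le> B) \<Longrightarrow>
    (\<integral>z. g z \<partial>density nu0 (\<lambda>z. ennreal (limit_fun c' \<alpha> z / (\<integral>x. limit_fun c' \<alpha> x \<partial>nu0))))
    = (\<integral>z. g z * gauss z \<partial>param_lborel (- {i0}) (\<lambda>i. axis i 1 - axis i0 1))
      / (\<integral>z. gauss z \<partial>param_lborel (- {i0}) (\<lambda>i. axis i 1 - axis i0 1))"
proof -
  let ?f = "limit_fun c' \<alpha>"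
  let ?I = "\<integral>x. ?f x \<partial>nu0" and ?\<nu> = "param_lborel (- {i0}) (\<lambda>i. axis i 1 - axis i0 1) :: (real ^ 'm) measure"
  obtain C where C: "0 < C"
    "\<And>g B. g \<in> borel_measurable borel \<Longrightarrow> (\<And>z. \<bar>g z\<bar> \<le> B) \<Longrightarrow> integrable nu0 (\<lambda>z. g z * ?f z)"
    "\<And>g B. g \<in> borel_measurable borel \<Longrightarrow> (\<And>z. \<bar>g z\<bar> \<le> B) \<Longrightarrow>
      (\<integral>z. g z * ?f z \<partial>nu0) = C * (\<integral>z. g z * gauss z \<partial>?\<nu>)"
    using nu0_limit_fun by blast
  have int: "integrable nu0 ?f" and I: "?I = C * (\<integral>z. gauss z \<partial>?\<nu>)"
    using C(2)[of "\<lambda>_. 1" 1] C(3)[of "\<lambda>_. 1" 1] by simp_all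
  have I_pos: "0 < ?I" unfolding I using C(1) integral_gauss_pos by simp
  have f_nonneg: "0 \<le> ?f z" for z
    by (simp add: limit_fun_def prod_nonneg)
  have sets: "sets nu0 = sets (borel :: (real ^ 'm) measure)"
    by (simp add: nu0_def subspace_lborel_def Let_def)
  have meas: "?f \<in> borel_measurable nu0" using int by (rule borel_measurable_integrable)
  show "prob_space (density nu0 (\<lambda>z. ennreal (?f z / ?I)))"
  proof
    have "emeasure (density nu0 (\<lambda>z. ennreal (?f z / ?I))) (space nu0) = (\<integral>\<^sup>+z. ennreal (?f z / ?I) \<partial>nu0)"
      using meas by (subst emeasure_density) (auto intro!: nn_integral_cong)
    also have "\<dots> = ennreal (\<integral>z. ?f z / ?I \<partial>nu0)"
      using int I_pos f_nonneg by (intro nn_integral_eq_integral) auto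
    also have "\<dots> = 1" using I_pos by simp
    finally show "emeasure (density nu0 (\<lambda>z. ennreal (?f z / ?I))) (space (density nu0 (\<lambda>z. ennreal (?f z / ?I)))) = 1"
      by simp
  qed
  assume g: "continuous_on UNIV g" and bdd: "\<And>z. \<bar>g z\<bar> \<le> B"
  have gm: "g \<in> borel_measurable borel" using g by (rule borel_measurable_continuous_onI)
  then have "g \<in> borel_measurable nu0" by (simp cong: measurable_cong_sets add: sets)
  then have "(\<integral>z. g z \<partial>density nu0 (\<lambda>z. ennreal (?f z / ?I))) = (\<integral>z. (?f z / ?I) *\<^sub>R g z \<partial>nu0)"
    using meas f_nonneg I_pos by (intro integral_density) auto
  also have "\<dots> = (\<integral>z. g z * ?f z / ?I \<partial>nu0)"
    by (intro Bochner_Integration.integral_cong) auto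
  also have "\<dots> = (\<integral>z. g z * ?f z \<partial>nu0) / ?I" by simp
  also have "\<dots> = (\<integral>z. g z * gauss z \<partial>?\<nu>) / (\<integral>z. gauss z \<partial>?\<nu>)"
    using C(1) unfolding I C(3)[OF gm bdd] by simp
  finally show "(\<integral>z. g z \<partial>density nu0 (\<lambda>z. ennreal (?f z / ?I)))
    = (\<integral>z. g z * gauss z \<partial>?\<nu>) / (\<integral>z. gauss z \<partial>?\<nu>)" .
qed

end

section \<open>The limit theorem: from the block model to the tilted setting\<close>

theorem theorem1p5:
  fixes \<alpha> p :: "'m::finite \<Rightarrow> real" and a :: real
    and m :: "nat \<Rightarrow> 'm \<Rightarrow> nat" and k :: "nat \<Rightarrow> nat"
    and P :: "nat \<Rightarrow> 'w measure" and X :: "nat \<Rightarrow> 'm \<Rightarrow> 'w \<Rightarrow> nat"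
  assumes "\<And>i. 0 < \<alpha> i" and "\<And>i. \<alpha> i < 1" and "(\<Sum>i\<in>UNIV. \<alpha> i) = 1"
    and "0 < a" and "a < 1"
    and "\<And>i. 0 < p i" and "\<And>i. p i < 1"
    and "\<And>n. n \<ge> 1 \<Longrightarrow> (\<Sum>i\<in>UNIV. m n i) = n"
    and "\<And>i. (\<lambda>n. real (m n i) / real n) \<longlonglongrightarrow> \<alpha> i"
    and "\<And>n. n \<ge> 1 \<Longrightarrow> k n \<le> n"
    and "(\<lambda>n. real (k n) / real n) \<longlonglongrightarrow> a"
    and "\<And>n. n \<ge> 1 \<Longrightarrow> prob_space (P n)"
    and "\<And>n. n \<ge> 1 \<Longrightarrow> prob_space.indep_vars (P n) (\<lambda>i. count_space UNIV) (X n) UNIV"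
    and "\<And>n i. n \<ge> 1 \<Longrightarrow>
           distr (P n) (count_space UNIV) (X n i) = measure_pmf (binomial_pmf (m n i) (p i))"
    and "a > (\<Sum>i\<in>UNIV. p i * \<alpha> i) \<or>
         filterlim (\<lambda>n. (real (k n) - (\<integral>\<omega>. real (\<Sum>i\<in>UNIV. X n i \<omega>) \<partial>P n)) / sqrt (real n))
           at_top sequentially"
  shows "let c = (\<lambda>n. block_probs p (m n) (k n));
             \<X> = (\<lambda>n \<omega>. \<chi> i. (real (X n i \<omega>) - c n i * real (m n i)) / sqrt (real n));
             f = limit_fun (limit_probs p \<alpha> a) \<alpha>;
             \<mu> = density nu0 (\<lambda>z. ennreal (f z / (\<integral>x. f x \<partial>nu0)))
         in prob_space \<mu> \<and>
            weakly_converges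
              (\<lambda>n. distr (uniform_measure (P n) {\<omega> \<in> space (P n). (\<Sum>i\<in>UNIV. X n i \<omega>) \<ge> k n})
                     borel (\<X> n))
              \<mu>"
proof -
  note \<alpha> = assms(1-3) and a = assms(4,5) and p = assms(6,7) and sum_m = assms(8) and m_lim = assms(9)
    and k_lim = assms(11) and P = assms(12) and indep = assms(13) and distr = assms(14)
  define c where "c n = block_probs p (m n) (k n)" for n
  \<comment> \<open>Any block can play the distinguished role.\<close>
  define i0 :: 'm where "i0 = undefined"
  let ?E = "\<lambda>n. \<Sum>i\<in>UNIV. p i * real (m n i)"
  have gt0: "\<forall>\<^sub>F n in sequentially. 1 \<le> (n::nat)" by (rule eventually_ge_at_top)
  have "\<forall>\<^sub>F n in sequentially. \<forall>i. 0 < m n i"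
  proof (rule eventually_all_finite)
    fix i
    have "\<forall>\<^sub>F n in sequentially. 0 < real (m n i) / real n"
      using \<alpha>(1)[of i] by (intro order_tendstoD(1)[OF m_lim]) auto
    then show "\<forall>\<^sub>F n in sequentially. 0 < m n i"
      by eventually_elim (auto simp: zero_less_divide_iff)
  qed
  moreover have "\<forall>\<^sub>F n in sequentially. 0 < real (k n) / real n" "\<forall>\<^sub>F n in sequentially. real (k n) / real n < 1"
    using a by (auto intro: order_tendstoD[OF k_lim])
  ultimately have block: "\<forall>\<^sub>F n in sequentially. is_block_probs p (m n) (k n) (c n)"
    using gt0
  proof eventually_elim
    case (elim n)
    then have "0 < k n" "k n < (\<Sum>i\<in>UNIV. m n i)" by (auto simp: sum_m zero_less_divide_iff divide_less_eq)
    then have "\<exists>!c. is_block_probs p (m n) (k n) c"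
      using elim(1) by (intro block_probs_ex1 p) auto
    then show ?case
      unfolding c_def block_probs_def by (rule theI')
  qed
  define tilts where "tilts n B \<longleftrightarrow> 0 < B \<and> (\<forall>i. c n i = p i / (p i + B * (1 - p i))) \<and>
      (\<forall>i. (1 - c n i) * p i = B * (c n i * (1 - p i)))" for n B
  \<comment> \<open>Arbitrary where no tilt exists, so the facts about \<open>A\<close> assume block
    probabilities or hold eventually.\<close>
  define A where "A n = (SOME B. tilts n B)" for n
  have tilts: "tilts n (A n)" if block: "is_block_probs p (m n) (k n) (c n)" for n
  proof -
    have "\<exists>B. tilts n B"
      by (rule is_block_probs_odds[OF p block]) (unfold tilts_def, blast)
    then show ?thesis unfolding A_def by (rule someI_ex)
  qed
  have odds: "0 < A n" "c n i = p i / (p i + A n * (1 - p i))" "(1 - c n i) * p i = A n * (c n i * (1 - p i))"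
    if "is_block_probs p (m n) (k n) (c n)" for n i
    using tilts[OF that] unfolding tilts_def by blast+
  have c_sum: "\<forall>\<^sub>F n in sequentially. (\<Sum>i\<in>UNIV. c n i * real (m n i)) = real (k n)"
    using block by eventually_elim (simp add: is_block_probs_def)
  have A_lim: "0 < tilt p \<alpha> a" "A \<longlonglongrightarrow> tilt p \<alpha> a"
  proof -
    have "\<forall>\<^sub>F n in sequentially. real (k n) / real n = (\<Sum>i\<in>UNIV. p i * (real (m n i) / real n) / (p i + A n * (1 - p i)))"
      using block c_sum
    proof eventually_elim
      case (elim n)
      have "(\<Sum>i\<in>UNIV. p i * (real (m n i) / real n) / (p i + A n * (1 - p i))) = (\<Sum>i\<in>UNIV. c n i * real (m n i)) / real n"
        unfolding sum_divide_distrib by (intro sum.cong) (simp_all add: odds(2)[OF elim(1)])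
      then show ?case using elim by simp
    qed
    from Lim_transform_eventually[OF k_lim this]
    have lim: "(\<lambda>n. \<Sum>i\<in>UNIV. p i * (real (m n i) / real n) / (p i + A n * (1 - p i))) \<longlonglongrightarrow> a" .
    have "\<forall>\<^sub>F n in sequentially. 0 < A n"
      using block by eventually_elim (rule odds(1))
    from tilt_tendsto[OF p \<alpha>(1) a(1) _ m_lim _ this lim] a \<alpha>(3)
    show "0 < tilt p \<alpha> a" "A \<longlonglongrightarrow> tilt p \<alpha> a" by auto
  qed
  have den: "0 < p i + tilt p \<alpha> a * (1 - p i)" for i
    using A_lim p[of i] by (simp add: add_pos_pos)
  have c_lim: "(\<lambda>n. c n i) \<longlonglongrightarrow> limit_probs p \<alpha> a i" for i
  proof -
    have "(\<lambda>n. p i / (p i + A n * (1 - p i))) \<longlonglongrightarrow> limit_probs p \<alpha> a i"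
      unfolding limit_probs_def using den[of i] by (intro tendsto_intros A_lim) auto
    moreover have "\<forall>\<^sub>F n in sequentially. p i / (p i + A n * (1 - p i)) = c n i"
      using block by eventually_elim (simp add: odds(2))
    ultimately show ?thesis by (rule Lim_transform_eventually)
  qed
  have excess: "filterlim (\<lambda>n. (real (k n) - ?E n) / sqrt (real n)) at_top sequentially"
    using assms(15)
  proof
    \<comment> \<open>This alternative is a special case of the other: the excess over
      \<open>n\<close> has a positive limit, so the excess over \<open>sqrt n\<close>
      diverges.\<close>
    assume gap: "(\<Sum>i\<in>UNIV. p i * \<alpha> i) < a"
    have sq: "filterlim (\<lambda>n. sqrt (real n)) at_top sequentially"
      by (rule filterlim_compose[OF sqrt_at_top filterlim_real_sequentially])
    have "(\<lambda>n. real (k n) / real n - (\<Sum>i\<in>UNIV. p i * (real (m n i) / real n))) \<longlonglongrightarrow> a - (\<Sum>i\<in>UNIV. p i * \<alpha> i)"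
      by (intro tendsto_intros k_lim m_lim)
    then have "filterlim (\<lambda>n. (real (k n) / real n - (\<Sum>i\<in>UNIV. p i * (real (m n i) / real n))) * sqrt (real n)) at_top sequentially"
      by (rule filterlim_tendsto_pos_mult_at_top) (use gap sq in auto)
    moreover have "(real (k n) / real n - (\<Sum>i\<in>UNIV. p i * (real (m n i) / real n))) * sqrt (real n) = (real (k n) - ?E n) / sqrt (real n)" for n
    proof -
      have "real (k n) / real n - (\<Sum>i\<in>UNIV. p i * (real (m n i) / real n)) = (real (k n) - ?E n) / real n"
        by (simp add: diff_divide_distrib sum_divide_distrib)
      moreover have "x / (s * s) * s = x / s" for x s :: real by simp
      from this[of "real (k n) - ?E n" "sqrt (real n)"]
      have "(real (k n) - ?E n) / real n * sqrt (real n) = (real (k n) - ?E n) / sqrt (real n)"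
        by (simp only: real_sqrt_mult_self abs_of_nat)
      ultimately show ?thesis by (simp only:)
    qed
    ultimately show ?thesis by simp
  next
    assume "filterlim (\<lambda>n. (real (k n) - (\<integral>\<omega>. real (\<Sum>i\<in>UNIV. X n i \<omega>) \<partial>P n)) / sqrt (real n)) at_top sequentially"
    moreover have "\<forall>\<^sub>F n in sequentially. (\<integral>\<omega>. real (\<Sum>i\<in>UNIV. X n i \<omega>) \<partial>P n) = ?E n"
      using gt0
    proof eventually_elim
      case (elim n)
      interpret prob_space "P n" by (rule P) fact
      show ?case
        by (rule expectation_sum_binomial[OF _ distr[OF elim] p]) (use indep[OF elim] in \<open>auto simp: indep_vars_def\<close>)
    qed
    ultimately show ?thesis
      by (elim filterlim_mono_eventually) (auto elim: eventually_mono)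
  qed
  have "\<forall>\<^sub>F n in sequentially. 0 < (real (k n) - ?E n) / sqrt (real n)"
    using excess by (simp add: filterlim_at_top_dense)
  \<comment> \<open>A positive excess forces \<open>A n < 1\<close>; dividing the bound of
    \<open>odds_excess_le\<close> by \<open>sqrt n\<close> makes \<open>sqrt n * (1 - A n)\<close>
    diverge with the scaled excess.\<close>
  then have A_ev: "\<forall>\<^sub>F n in sequentially. A n < 1 \<and> (real (k n) - ?E n) / sqrt (real n) \<le> sqrt (real n) * (1 - A n)"
    using block c_sum gt0
  proof eventually_elim
    case (elim n)
    have "?E n < (\<Sum>i\<in>UNIV. c n i * real (m n i))" using elim by (simp add: zero_less_divide_iff)
    from odds_excess_le[OF p odds(1,2)[OF elim(2)] _ this] have "A n < 1"
      "real (k n) - ?E n \<le> (1 - A n) * (\<Sum>i\<in>UNIV. real (m n i))" using elim by auto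
    moreover have "(\<Sum>i\<in>UNIV. real (m n i)) = real n"
      using sum_m[OF elim(4)] by (simp only: of_nat_sum[symmetric])
    ultimately have "A n < 1" "(real (k n) - ?E n) / sqrt (real n) \<le> (1 - A n) * real n / sqrt (real n)"
      by (auto intro: divide_right_mono)
    moreover have "(1 - A n) * real n / sqrt (real n) = sqrt (real n) * (1 - A n)"
      unfolding times_divide_eq_right[symmetric] by (simp add: real_div_sqrt)
    ultimately show ?case by simp
  qed
  interpret tilted_blocks \<alpha> "limit_probs p \<alpha> a" m k c A i0
  proof
    show "0 < \<alpha> i" for i by (rule \<alpha>)
    have "0 < tilt p \<alpha> a * (1 - p i)" for i using A_lim p[of i] by simp
    then show "0 < limit_probs p \<alpha> a i" "limit_probs p \<alpha> a i < 1" for i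
      unfolding limit_probs_def using p(1)[of i] den[of i] by auto
    show "(\<lambda>n. real (m n i) / real n) \<longlonglongrightarrow> \<alpha> i" for i by (rule m_lim)
    show "(\<lambda>n. c n i) \<longlonglongrightarrow> limit_probs p \<alpha> a i" for i by (rule c_lim)
    show "\<forall>\<^sub>F n in sequentially. \<forall>i. m n i \<le> n"
      using gt0
    proof eventually_elim
      case (elim n)
      show ?case using member_le_sum[of _ UNIV "m n"] by (simp add: sum_m[OF elim])
    qed
    show "\<forall>\<^sub>F n in sequentially. (\<Sum>i\<in>UNIV. c n i * real (m n i)) = real (k n)" by (rule c_sum)
    show "\<forall>\<^sub>F n in sequentially. 0 < A n \<and> A n < 1"
      using block A_ev by eventually_elim (use odds(1) in auto)
    show "filterlim (\<lambda>n. sqrt (real n) * (1 - A n)) at_top sequentially"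
      using A_ev by (intro filterlim_at_top_mono[OF excess]) (auto elim: eventually_mono)
  qed
  let ?\<mu> = "density nu0 (\<lambda>z. ennreal (limit_fun (limit_probs p \<alpha> a) \<alpha> z / (\<integral>x. limit_fun (limit_probs p \<alpha> a) \<alpha> x \<partial>nu0)))"
  let ?M = "\<Pi>\<^sub>M i\<in>UNIV. (lborel :: real measure)" and ?\<nu> = "param_lborel (- {i0}) (\<lambda>i. axis i 1 - axis i0 1) :: (real ^ 'm) measure"
  have "weakly_converges
      (\<lambda>n. distr (uniform_measure (P n) {\<omega> \<in> space (P n). k n \<le> (\<Sum>i\<in>UNIV. X n i \<omega>)}) borel
        (\<lambda>\<omega>. centred n (\<lambda>i. real (X n i \<omega>)))) ?\<mu>"
    unfolding weakly_converges_def
  proof (intro allI impI)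
    fix g :: "real ^ 'm \<Rightarrow> real"
    assume g: "continuous_on UNIV g" and "bounded (range g)"
    then obtain B where B: "\<bar>g z\<bar> \<le> B" for z by (auto simp: bounded_iff)
    have one: "(\<lambda>n. \<integral>u. integrand n (\<lambda>_. 1) u \<partial>?M) \<longlonglongrightarrow> (\<integral>z. gauss z \<partial>?\<nu>)"
      using integrand_tendsto(2)[of "\<lambda>_. 1" 1] by simp
    then have lim: "(\<lambda>n. (\<integral>u. integrand n g u \<partial>?M) / (\<integral>u. integrand n (\<lambda>_. 1) u \<partial>?M))
        \<longlonglongrightarrow> (\<integral>z. g z \<partial>?\<mu>)"
      unfolding integral_limit[OF g B] using integral_gauss_pos
      by (intro tendsto_divide integrand_tendsto(2)[OF g B]) auto
    \<comment> \<open>The denominators have a positive limit, so for large \<open>n\<close> the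
      conditioning events have positive probability.\<close>
    have "\<forall>\<^sub>F n in sequentially. 0 < (\<integral>u. integrand n (\<lambda>_. 1) u \<partial>?M)"
      using integral_gauss_pos by (intro order_tendstoD(1)[OF one])
    then have "\<forall>\<^sub>F n in sequentially. (\<integral>u. integrand n g u \<partial>?M) / (\<integral>u. integrand n (\<lambda>_. 1) u \<partial>?M)
        = (\<integral>x. g x \<partial>distr (uniform_measure (P n) {\<omega> \<in> space (P n). k n \<le> (\<Sum>i\<in>UNIV. X n i \<omega>)}) borel
            (\<lambda>\<omega>. centred n (\<lambda>i. real (X n i \<omega>))))"
      using block A_ev gt0
    proof eventually_elim
      case (elim n)
      show ?case
        by (rule conditional_expectation_eq[OF P indep distr p, symmetric])
           (use elim odds[OF elim(2)] g in \<open>auto simp: is_block_probs_def intro: borel_measurable_continuous_onI\<close>)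
    qed
    from Lim_transform_eventually[OF lim this]
    show "(\<lambda>n. \<integral>x. g x \<partial>distr (uniform_measure (P n) {\<omega> \<in> space (P n). k n \<le> (\<Sum>i\<in>UNIV. X n i \<omega>)}) borel
        (\<lambda>\<omega>. centred n (\<lambda>i. real (X n i \<omega>)))) \<longlonglongrightarrow> (\<integral>z. g z \<partial>?\<mu>)" .
  qed
  with prob_space_limit show ?thesis
    unfolding Let_def centred_def c_def by simp
qed

end
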